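(* Let $\Phi$ be a real root system with Weyl group $W$, complexified reflection representation $V$ with $W$-invariant symmetric form $B$, and let $k:\Phi\to\mathbb C$ be a $W$-invariant parameter function. Then $$\big(\nu'(\Omega'_W)\big)_0=\tfrac12B(\rho_k,\rho_k)-\tfrac18\sum_{\alpha,\beta>0}k_\alpha k_\beta\frac{B(\alpha,\beta)^3}{B(\alpha,\alpha)B(\beta,\beta)},$$ where $\rho_k=\frac12\sum_{\alpha>0}k_\alpha\alpha\in V^*$.
   Context: $(V_0^*,\Phi,V_0,\Phi^\vee)$ is a real root system with coroots $\alpha^\vee\in V_0$, reflections $s_\alpha(v)=v-\alpha(v)\alpha^\vee$, finite Weyl group $W$, and $B$ a positive-definite $W$-invariant symmetric bilinear form on $V_0$, extended complex-bilinearly to $V=\mathbb C\otimes_{\mathbb R}V_0$; $B$ also denotes the dual form on $V^*$. Fix positive roots; $\alpha>0$ means $\alpha$ is positive. $\mathcal W=\mathcal W(V\oplus V^*,\omega)$ is the Weyl algebra: the quotient of the tensor algebra of $V\oplus V^*$ by $vw-wv=\omega(v,w)$, where $V,V^*$ are isotropic and $\omega(\lambda,v)=\lambda(v)$ for $\lambda\in V^*,v\in V$. $\nu':\mathfrak{so}(V,B)\to\mathcal W$ is $\nu'(f)=\sum_if(v_i)v_i^*$ ($\{v_i\}$ a basis of $V$, $\{v_i^*\}$ the dual basis of $V^*$). Set $$\nu'(\Omega'_W)=\frac1{16}\sum_{\alpha,\beta>0}k_\alpha k_\beta\frac1{B(\alpha^\vee,\beta^\vee)}\nu'([s_\alpha,s_\beta])^2\in\mathcal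 W,$$ where $[s_\alpha,s_\beta]=s_\alpha s_\beta-s_\beta s_\alpha$ is regarded in $\mathfrak{so}(V,B)$ and pairs with $B(\alpha^\vee,\beta^\vee)=0$ (for which $[s_\alpha,s_\beta]=0$) contribute $0$. $\eta:\mathcal W\to S(V\oplus V^* )$ is the linear isomorphism inverse to the symmetrization map $Q(u_1\cdots u_m)=\frac1{m!}\sum_{\sigma\in S_m}u_{\sigma(1)}\cdots u_{\sigma(m)}$, and $(x)_0$ denotes the degree $0$ component of $\eta(x)$. *)

theory Defs
  imports "HOL-Analysis.Analysis" "HOL-Library.Poly_Mapping" "HOL-Combinatorics.Permutations"
begin

section \<open>Complex vector spaces, complexification, dual\<close>

class complex_vector = ab_group_add +
  fixes scaleC :: "complex \<Rightarrow> 'a \<Rightarrow> 'a"  (infixr \<open>*\<^sub>C\<close> 75)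
  assumes scaleC_add_right: "a *\<^sub>C (x + y) = a *\<^sub>C x + a *\<^sub>C y"
    and scaleC_add_left: "(a + b) *\<^sub>C x = a *\<^sub>C x + b *\<^sub>C x"
    and scaleC_scaleC: "a *\<^sub>C b *\<^sub>C x = (a * b) *\<^sub>C x"
    and scaleC_one: "1 *\<^sub>C x = x"

global_interpretation cvec: vector_space "scaleC :: complex \<Rightarrow> 'a \<Rightarrow> 'a::complex_vector"
  by unfold_locales (simp_all add: scaleC_add_right scaleC_add_left scaleC_scaleC scaleC_one)

abbreviation clinear :: "('a::complex_vector \<Rightarrow> 'b::complex_vector) \<Rightarrow> bool"
  where "clinear \<equiv> Vector_Spaces.linear scaleC scaleC"

lemma clinear_iff:
  "clinear f \<longleftrightarrow> (\<forall>x y. f (x + y) = f x + f y) \<and> (\<forall>c x. f (c *\<^sub>C x) = c *\<^sub>C f x)"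
  by (auto simp: Vector_Spaces.linear_def module_hom_def module_hom_axioms_def
      cvec.vector_space_axioms cvec.module_axioms)

instantiation complex :: complex_vector
begin
definition "scaleC (a::complex) (x::complex) = a * x"
instance by standard (simp_all add: scaleC_complex_def algebra_simps)
end

instantiation prod :: (complex_vector, complex_vector) complex_vector
begin
definition "scaleC a (p :: 'a \<times> 'b) = (a *\<^sub>C fst p, a *\<^sub>C snd p)"
instance
  by standard
    (simp_all add: scaleC_prod_def prod_eq_iff scaleC_add_right scaleC_add_left scaleC_scaleC scaleC_one)
end

text \<open>\<open>Cplx x y\<close> stands for \<open>1 \<otimes> x + \<i> \<otimes> y\<close> in the complexification of \<open>'v\<close>.\<close>

datatype 'v cplx = Cplx (re_part: 'v) (im_part: 'v)

instantiation cplx :: (real_vector) complex_vector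
begin
definition "(0 :: 'a cplx) = Cplx 0 0"
definition "x + y = Cplx (re_part x + re_part y) (im_part x + im_part (y :: 'a cplx))"
definition "x - y = Cplx (re_part x - re_part y) (im_part x - im_part (y :: 'a cplx))"
definition "- x = Cplx (- re_part x) (- im_part (x :: 'a cplx))"
definition "scaleC c x = Cplx (Re c *\<^sub>R re_part x - Im c *\<^sub>R im_part x)
                              (Re c *\<^sub>R im_part x + Im c *\<^sub>R re_part (x :: 'a cplx))"
instance
  by standard (simp_all add: zero_cplx_def plus_cplx_def minus_cplx_def uminus_cplx_def
      scaleC_cplx_def cplx.expand algebra_simps)
end

typedef (overloaded) 'u cdual = "{f :: 'u::complex_vector \<Rightarrow> complex. clinear f}"
  morphisms ev Abs_cdual
  by (rule exI[of _ "\<lambda>_. 0"]) (simp add: clinear_iff)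

setup_lifting type_definition_cdual

instantiation cdual :: (complex_vector) complex_vector
begin
lift_definition zero_cdual :: "'a cdual" is "\<lambda>_. 0"
  by (simp add: clinear_iff)
lift_definition plus_cdual :: "'a cdual \<Rightarrow> 'a cdual \<Rightarrow> 'a cdual" is "\<lambda>f g v. f v + g v"
  by (simp add: clinear_iff scaleC_complex_def algebra_simps)
lift_definition minus_cdual :: "'a cdual \<Rightarrow> 'a cdual \<Rightarrow> 'a cdual" is "\<lambda>f g v. f v - g v"
  by (simp add: clinear_iff scaleC_complex_def algebra_simps)
lift_definition uminus_cdual :: "'a cdual \<Rightarrow> 'a cdual" is "\<lambda>f v. - f v"
  by (simp add: clinear_iff scaleC_complex_def algebra_simps)
lift_definition scaleC_cdual :: "complex \<Rightarrow> 'a cdual \<Rightarrow> 'a cdual" is "\<lambda>c f v. c * f v"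
  by (simp add: clinear_iff scaleC_complex_def algebra_simps)
instance by standard (transfer; simp add: fun_eq_iff algebra_simps)+
end

section \<open>Tensor, symmetric and Weyl algebras\<close>

text \<open>The sort \<open>{ring, monoid_mult}\<close> is that of unital associative rings; \<open>ring_1\<close> would in addition
  demand \<open>0 \<noteq> 1\<close>, which for the Weyl algebra is a theorem.\<close>

definition two_sided_ideal :: "'r::{ring, monoid_mult} set \<Rightarrow> bool" where
  "two_sided_ideal I \<longleftrightarrow> 0 \<in> I \<and> (\<forall>x\<in>I. \<forall>y\<in>I. x + y \<in> I) \<and> (\<forall>x\<in>I. \<forall>a. a * x \<in> I \<and> x * a \<in> I)"

definition ideal_cong :: "'r::{ring, monoid_mult} set \<Rightarrow> 'r \<Rightarrow> 'r \<Rightarrow> bool" where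
  "ideal_cong S x y \<longleftrightarrow> x - y \<in> two_sided_ideal hull S"

lemma two_sided_ideal_hull: "two_sided_ideal (two_sided_ideal hull S)"
  by (rule hull_in) (auto simp: two_sided_ideal_def)

lemma ideal_hull_zero: "0 \<in> two_sided_ideal hull S"
  and ideal_hull_add: "x \<in> two_sided_ideal hull S \<Longrightarrow> y \<in> two_sided_ideal hull S \<Longrightarrow> x + y \<in> two_sided_ideal hull S"
  and ideal_hull_mult_left: "x \<in> two_sided_ideal hull S \<Longrightarrow> a * x \<in> two_sided_ideal hull S"
  and ideal_hull_mult_right: "x \<in> two_sided_ideal hull S \<Longrightarrow> x * a \<in> two_sided_ideal hull S"
  using two_sided_ideal_hull[of S] by (auto simp: two_sided_ideal_def)

lemma ideal_hull_uminus: "x \<in> two_sided_ideal hull S \<Longrightarrow> - x \<in> two_sided_ideal hull S"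
  using ideal_hull_mult_left[of x S "-1"] by simp

lemma ideal_hull_diff:
  "x \<in> two_sided_ideal hull S \<Longrightarrow> y \<in> two_sided_ideal hull S \<Longrightarrow> x - y \<in> two_sided_ideal hull S"
  using ideal_hull_add[of x S "- y"] ideal_hull_uminus by fastforce

lemma ideal_cong_refl: "ideal_cong S x x"
  by (simp add: ideal_cong_def ideal_hull_zero)

lemma equivp_ideal_cong: "equivp (ideal_cong S)"
proof (rule equivpI)
  show "reflp (ideal_cong S)" by (simp add: reflp_def ideal_cong_refl)
  show "symp (ideal_cong S)"
    unfolding symp_def ideal_cong_def using ideal_hull_uminus[where S = S]
    by (metis minus_diff_eq)
  show "transp (ideal_cong S)"
    unfolding transp_def ideal_cong_def using ideal_hull_add[where S = S]
    by (metis diff_add_cancel add_diff_eq)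
qed

lemma ideal_cong_add: "ideal_cong S x x' \<Longrightarrow> ideal_cong S y y' \<Longrightarrow> ideal_cong S (x + y) (x' + y')"
  unfolding ideal_cong_def using ideal_hull_add[of "x - x'" S "y - y'"] by (simp add: algebra_simps)

lemma ideal_cong_diff: "ideal_cong S x x' \<Longrightarrow> ideal_cong S y y' \<Longrightarrow> ideal_cong S (x - y) (x' - y')"
  unfolding ideal_cong_def using ideal_hull_diff[of "x - x'" S "y - y'"] by (simp add: algebra_simps)

lemma ideal_cong_uminus: "ideal_cong S x x' \<Longrightarrow> ideal_cong S (- x) (- x')"
  unfolding ideal_cong_def using ideal_hull_uminus[of "x - x'" S] by (simp add: algebra_simps)

lemma ideal_cong_mult:
  assumes "ideal_cong S x x'" "ideal_cong S y y'"
  shows "ideal_cong S (x * y) (x' * y')"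
proof -
  have "x * y - x' * y' = (x - x') * y + x' * (y - y')" by (simp add: algebra_simps)
  then show ?thesis
    using assms unfolding ideal_cong_def
    by (simp add: ideal_hull_add ideal_hull_mult_left ideal_hull_mult_right)
qed

text \<open>Words, with concatenation as (additively written) monoid operation, so that
  \<open>'u word_mon \<Rightarrow>\<^sub>0 complex\<close> with its convolution product is the free associative unital
  complex algebra on the underlying set of \<open>'u\<close>.\<close>

datatype 'u word_mon = Word (letters: "'u list")

instantiation word_mon :: (type) monoid_add
begin
definition "(0 :: 'a word_mon) = Word []"
definition "x + y = Word (letters x @ letters (y :: 'a word_mon))"
instance by standard (simp_all add: zero_word_mon_def plus_word_mon_def)
end

type_synonym 'u free_alg = "'u word_mon \<Rightarrow>\<^sub>0 complex"

abbreviation free_gen :: "'u \<Rightarrow> 'u free_alg" where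
  "free_gen u \<equiv> Poly_Mapping.single (Word [u]) 1"

abbreviation free_const :: "complex \<Rightarrow> 'u free_alg" where
  "free_const c \<equiv> Poly_Mapping.single 0 c"

text \<open>The tensor algebra, presented as the free algebra on the set of vectors modulo linearity of
  the inclusion of the vectors.\<close>

definition tensor_rels :: "'u::complex_vector free_alg set" where
  "tensor_rels = {free_gen (u + w) - (free_gen u + free_gen w) | u w. True}
               \<union> {free_gen (c *\<^sub>C u) - free_const c * free_gen u | c u. True}"

quotient_type (overloaded) 'u tensor_alg =
  "'u::complex_vector word_mon \<Rightarrow>\<^sub>0 complex" / "ideal_cong tensor_rels"
  by (rule equivp_ideal_cong)


instantiation tensor_alg :: (complex_vector) "{ring, monoid_mult, complex_vector}"
begin
lift_definition zero_tensor_alg :: "'a tensor_alg" is 0 .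
lift_definition one_tensor_alg :: "'a tensor_alg" is 1 .
lift_definition plus_tensor_alg :: "'a tensor_alg \<Rightarrow> 'a tensor_alg \<Rightarrow> 'a tensor_alg" is "(+)"
  by (rule ideal_cong_add)
lift_definition minus_tensor_alg :: "'a tensor_alg \<Rightarrow> 'a tensor_alg \<Rightarrow> 'a tensor_alg" is "(-)"
  by (rule ideal_cong_diff)
lift_definition uminus_tensor_alg :: "'a tensor_alg \<Rightarrow> 'a tensor_alg" is uminus
  by (rule ideal_cong_uminus)
lift_definition times_tensor_alg :: "'a tensor_alg \<Rightarrow> 'a tensor_alg \<Rightarrow> 'a tensor_alg" is "(*)"
  by (rule ideal_cong_mult)
lift_definition scaleC_tensor_alg :: "complex \<Rightarrow> 'a tensor_alg \<Rightarrow> 'a tensor_alg"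
  is "\<lambda>c x. free_const c * x"
  by (rule ideal_cong_mult[OF ideal_cong_refl])
instance
  by standard
    (transfer; simp add: algebra_simps single_add mult_single ideal_cong_refl
      flip: mult.assoc)+
end

lift_definition tensor_vec :: "'u::complex_vector \<Rightarrow> 'u tensor_alg" is free_gen .

lemma scaleC_tensor_alg_mult: "(c *\<^sub>C x) * y = c *\<^sub>C (x * (y :: 'u::complex_vector tensor_alg))"
  by transfer (simp add: mult.assoc ideal_cong_refl)

lemma ideal_cong_scaleC:
  fixes x y :: "'u::complex_vector tensor_alg"
  assumes "ideal_cong S x y"
  shows "ideal_cong S (c *\<^sub>C x) (c *\<^sub>C y)"
  using ideal_cong_mult[OF ideal_cong_refl[of S "c *\<^sub>C 1"] assms]
  by (simp add: scaleC_tensor_alg_mult)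

definition sym_rels :: "'u::complex_vector tensor_alg set" where
  "sym_rels = {tensor_vec u * tensor_vec w - tensor_vec w * tensor_vec u | u w. True}"

quotient_type (overloaded) 'u sym_alg = "'u::complex_vector tensor_alg" / "ideal_cong sym_rels"
  by (rule equivp_ideal_cong)

instantiation sym_alg :: (complex_vector) "{ring, monoid_mult, complex_vector}"
begin
lift_definition zero_sym_alg :: "'a sym_alg" is 0 .
lift_definition one_sym_alg :: "'a sym_alg" is 1 .
lift_definition plus_sym_alg :: "'a sym_alg \<Rightarrow> 'a sym_alg \<Rightarrow> 'a sym_alg" is "(+)"
  by (rule ideal_cong_add)
lift_definition minus_sym_alg :: "'a sym_alg \<Rightarrow> 'a sym_alg \<Rightarrow> 'a sym_alg" is "(-)"
  by (rule ideal_cong_diff)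
lift_definition uminus_sym_alg :: "'a sym_alg \<Rightarrow> 'a sym_alg" is uminus
  by (rule ideal_cong_uminus)
lift_definition times_sym_alg :: "'a sym_alg \<Rightarrow> 'a sym_alg \<Rightarrow> 'a sym_alg" is "(*)"
  by (rule ideal_cong_mult)
lift_definition scaleC_sym_alg :: "complex \<Rightarrow> 'a sym_alg \<Rightarrow> 'a sym_alg" is scaleC
  by (rule ideal_cong_scaleC)
instance
  by standard
    (transfer; simp add: algebra_simps scaleC_add_right scaleC_add_left scaleC_scaleC scaleC_one
      ideal_cong_refl)+
end

definition sym_vec :: "'u::complex_vector \<Rightarrow> 'u sym_alg" where
  "sym_vec u = abs_sym_alg (tensor_vec u)"

text \<open>The symplectic form on \<open>V \<oplus> V\<^sup>*\<close>: both summands are isotropic and \<open>\<omega>(\<lambda>, v) = \<lambda>(v)\<close>.\<close>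

definition symp_form :: "'u::complex_vector \<times> 'u cdual \<Rightarrow> 'u \<times> 'u cdual \<Rightarrow> complex" where
  "symp_form a b = ev (snd a) (fst b) - ev (snd b) (fst a)"

definition weyl_rels :: "('u::complex_vector \<times> 'u cdual) tensor_alg set" where
  "weyl_rels = {tensor_vec a * tensor_vec b - tensor_vec b * tensor_vec a - symp_form a b *\<^sub>C 1 | a b. True}"

quotient_type (overloaded) 'u weyl_alg =
  "('u::complex_vector \<times> 'u cdual) tensor_alg" / "ideal_cong weyl_rels"
  by (rule equivp_ideal_cong)

instantiation weyl_alg :: (complex_vector) "{ring, monoid_mult, complex_vector}"
begin
lift_definition zero_weyl_alg :: "'a weyl_alg" is 0 .
lift_definition one_weyl_alg :: "'a weyl_alg" is 1 .
lift_definition plus_weyl_alg :: "'a weyl_alg \<Rightarrow> 'a weyl_alg \<Rightarrow> 'a weyl_alg" is "(+)"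
  by (rule ideal_cong_add)
lift_definition minus_weyl_alg :: "'a weyl_alg \<Rightarrow> 'a weyl_alg \<Rightarrow> 'a weyl_alg" is "(-)"
  by (rule ideal_cong_diff)
lift_definition uminus_weyl_alg :: "'a weyl_alg \<Rightarrow> 'a weyl_alg" is uminus
  by (rule ideal_cong_uminus)
lift_definition times_weyl_alg :: "'a weyl_alg \<Rightarrow> 'a weyl_alg \<Rightarrow> 'a weyl_alg" is "(*)"
  by (rule ideal_cong_mult)
lift_definition scaleC_weyl_alg :: "complex \<Rightarrow> 'a weyl_alg \<Rightarrow> 'a weyl_alg" is scaleC
  by (rule ideal_cong_scaleC)
instance
  by standard
    (transfer; simp add: algebra_simps scaleC_add_right scaleC_add_left scaleC_scaleC scaleC_one
      ideal_cong_refl)+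
end

definition weyl_vec :: "'u::complex_vector \<times> 'u cdual \<Rightarrow> 'u weyl_alg" where
  "weyl_vec a = abs_weyl_alg (tensor_vec a)"

section \<open>Symmetrization\<close>

definition symmetrization :: "('u::complex_vector \<times> 'u cdual) sym_alg \<Rightarrow> 'u weyl_alg" where
  "symmetrization = (THE Q. clinear Q \<and>
     (\<forall>us. Q (prod_list (map sym_vec us)) =
        (1 / fact (length us)) *\<^sub>C
          (\<Sum>\<sigma> | \<sigma> permutes {..<length us}.
             prod_list (map (\<lambda>i. weyl_vec (us ! \<sigma> i)) [0..<length us]))))"

definition eta :: "'u::complex_vector weyl_alg \<Rightarrow> ('u \<times> 'u cdual) sym_alg" where
  "eta = inv symmetrization"

definition sym_grade :: "nat \<Rightarrow> 'u::complex_vector sym_alg set" where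
  "sym_grade m = cvec.span {prod_list (map sym_vec us) | us. length us = m}"

text \<open>The degree zero component of an element of the symmetric algebra, as a complex number.\<close>

definition sym_deg0 :: "'u::complex_vector sym_alg \<Rightarrow> complex" where
  "sym_deg0 x = (THE c. x - c *\<^sub>C 1 \<in> cvec.span (\<Union>m\<in>{1..}. sym_grade m))"

definition deg0 :: "'u::complex_vector weyl_alg \<Rightarrow> complex" where
  "deg0 x = sym_deg0 (eta x)"

section \<open>Root systems\<close>

text \<open>Elements of \<open>V\<^sub>0\<^sup>*\<close> are linear functions \<open>'v \<Rightarrow> real\<close>; \<open>coroot \<alpha>\<close> is \<open>\<alpha>\<^sup>\<or>\<close>. Roots are not
  required to be crystallographic, to be reduced, or to span \<open>V\<^sub>0\<^sup>*\<close>.\<close>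

locale real_root_system =
  fixes Phi :: "('v::real_vector \<Rightarrow> real) set"
    and coroot :: "('v \<Rightarrow> real) \<Rightarrow> 'v"
  assumes finite_dim: "\<exists>S::'v set. finite S \<and> span S = UNIV"
    and finite_roots: "finite Phi"
    and linear_root: "\<alpha> \<in> Phi \<Longrightarrow> linear \<alpha>"
    and coroot_inj: "inj_on coroot Phi"
    and root_coroot: "\<alpha> \<in> Phi \<Longrightarrow> \<alpha> (coroot \<alpha>) = 2"
    and reflect_roots: "\<alpha> \<in> Phi \<Longrightarrow> (\<lambda>\<beta> v. \<beta> v - \<beta> (coroot \<alpha>) * \<alpha> v) ` Phi = Phi"
    and reflect_coroots: "\<alpha> \<in> Phi \<Longrightarrow> (\<lambda>v. v - \<alpha> v *\<^sub>R coroot \<alpha>) ` coroot ` Phi = coroot ` Phi"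

text \<open>Closure under composition with reflections suffices, because they are involutions.\<close>

inductive_set weyl_group ::
  "('v::real_vector \<Rightarrow> real) set \<Rightarrow> (('v \<Rightarrow> real) \<Rightarrow> 'v) \<Rightarrow> ('v \<Rightarrow> 'v) set"
  for Phi and coroot where
  "id \<in> weyl_group Phi coroot"
| "w \<in> weyl_group Phi coroot \<Longrightarrow> \<alpha> \<in> Phi \<Longrightarrow>
     (\<lambda>v. v - \<alpha> v *\<^sub>R coroot \<alpha>) \<circ> w \<in> weyl_group Phi coroot"

definition positive_system :: "('v::real_vector \<Rightarrow> real) set \<Rightarrow> ('v \<Rightarrow> real) set \<Rightarrow> bool" where
  "positive_system Phi P \<longleftrightarrow> (\<exists>x. (\<forall>\<alpha>\<in>Phi. \<alpha> x \<noteq> 0) \<and> P = {\<alpha> \<in> Phi. \<alpha> x > 0})"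

definition pos_def_form :: "('v::real_vector \<Rightarrow> 'v \<Rightarrow> real) \<Rightarrow> bool" where
  "pos_def_form B \<longleftrightarrow> bilinear B \<and> (\<forall>x y. B x y = B y x) \<and> (\<forall>x. x \<noteq> 0 \<longrightarrow> B x x > 0)"

definition invariant_form ::
  "('v::real_vector \<Rightarrow> real) set \<Rightarrow> (('v \<Rightarrow> real) \<Rightarrow> 'v) \<Rightarrow> ('v \<Rightarrow> 'v \<Rightarrow> real) \<Rightarrow> bool" where
  "invariant_form Phi coroot B \<longleftrightarrow>
     (\<forall>w\<in>weyl_group Phi coroot. \<forall>x y. B (w x) (w y) = B x y)"

text \<open>\<open>w\<close> acts on a functional \<open>\<alpha>\<close> by \<open>\<alpha> \<circ> w\<^sup>-\<^sup>1\<close>.\<close>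

definition invariant_param ::
  "('v::real_vector \<Rightarrow> real) set \<Rightarrow> (('v \<Rightarrow> real) \<Rightarrow> 'v) \<Rightarrow> (('v \<Rightarrow> real) \<Rightarrow> complex) \<Rightarrow> bool" where
  "invariant_param Phi coroot k \<longleftrightarrow>
     (\<forall>w\<in>weyl_group Phi coroot. \<forall>\<alpha>\<in>Phi. k (\<alpha> \<circ> inv w) = k \<alpha>)"

section \<open>The complexified picture\<close>

definition cplx_vec :: "'v::real_vector \<Rightarrow> 'v cplx" where
  "cplx_vec x = Cplx x 0"

definition cplx_fun :: "('v::real_vector \<Rightarrow> real) \<Rightarrow> 'v cplx cdual" where
  "cplx_fun \<alpha> = Abs_cdual (\<lambda>v. Complex (\<alpha> (re_part v)) (\<alpha> (im_part v)))"

definition cplx_form :: "('v::real_vector \<Rightarrow> 'v \<Rightarrow> real) \<Rightarrow> 'v cplx \<Rightarrow> 'v cplx \<Rightarrow> complex" where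
  "cplx_form B v w = Complex
     (B (re_part v) (re_part w) - B (im_part v) (im_part w))
     (B (re_part v) (im_part w) + B (im_part v) (re_part w))"

text \<open>The form on the dual space transported along the isomorphism \<open>v \<mapsto> F v\<close> given by a
  nondegenerate form \<open>F\<close>.\<close>

definition riesz :: "('u::complex_vector \<Rightarrow> 'u \<Rightarrow> complex) \<Rightarrow> 'u cdual \<Rightarrow> 'u" where
  "riesz F l = (THE v. \<forall>w. F v w = ev l w)"

definition dual_form ::
  "('u::complex_vector \<Rightarrow> 'u \<Rightarrow> complex) \<Rightarrow> 'u cdual \<Rightarrow> 'u cdual \<Rightarrow> complex" where
  "dual_form F l m = F (riesz F l) (riesz F m)"

abbreviation Bdual ::
  "('v::real_vector \<Rightarrow> 'v \<Rightarrow> real) \<Rightarrow> 'v cplx cdual \<Rightarrow> 'v cplx cdual \<Rightarrow> complex" where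
  "Bdual B \<equiv> dual_form (cplx_form B)"

definition crefl ::
  "(('v::real_vector \<Rightarrow> real) \<Rightarrow> 'v) \<Rightarrow> ('v \<Rightarrow> real) \<Rightarrow> 'v cplx \<Rightarrow> 'v cplx" where
  "crefl coroot \<alpha> v = v - ev (cplx_fun \<alpha>) v *\<^sub>C cplx_vec (coroot \<alpha>)"

definition commutator :: "('u::complex_vector \<Rightarrow> 'u) \<Rightarrow> ('u \<Rightarrow> 'u) \<Rightarrow> 'u \<Rightarrow> 'u" where
  "commutator f g v = f (g v) - g (f v)"

definition dual_vec :: "'u::complex_vector set \<Rightarrow> 'u \<Rightarrow> 'u cdual" where
  "dual_vec E e = Abs_cdual (\<lambda>v. cvec.representation E v e)"

text \<open>\<open>\<nu>'\<close>, computed in the basis \<open>E\<close>. The formula makes sense for every endomorphism; it is applied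
  below only to commutators of reflections, which lie in \<open>\<ss>\<oo>(V, B)\<close>.\<close>

definition nu :: "'u::complex_vector set \<Rightarrow> ('u \<Rightarrow> 'u) \<Rightarrow> 'u weyl_alg" where
  "nu E f = (\<Sum>e\<in>E. weyl_vec (f e, 0) * weyl_vec (0, dual_vec E e))"

text \<open>Pairs with \<open>B(\<alpha>\<^sup>\<or>, \<beta>\<^sup>\<or>) = 0\<close> contribute \<open>0\<close>, since then the quotient is \<open>0\<close> by the
  convention \<open>x / 0 = 0\<close>.\<close>

definition nu_Omega ::
  "(('v::real_vector \<Rightarrow> real) \<Rightarrow> 'v) \<Rightarrow> ('v \<Rightarrow> real) set \<Rightarrow> ('v \<Rightarrow> 'v \<Rightarrow> real) \<Rightarrow>
     (('v \<Rightarrow> real) \<Rightarrow> complex) \<Rightarrow> 'v cplx set \<Rightarrow> 'v cplx weyl_alg" where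
  "nu_Omega coroot P B k E = (1/16) *\<^sub>C (\<Sum>\<alpha>\<in>P. \<Sum>\<beta>\<in>P.
     (k \<alpha> * k \<beta> * (1 / cplx_form B (cplx_vec (coroot \<alpha>)) (cplx_vec (coroot \<beta>)))) *\<^sub>C
       (nu E (commutator (crefl coroot \<alpha>) (crefl coroot \<beta>)))\<^sup>2)"

definition rho :: "('v::real_vector \<Rightarrow> real) set \<Rightarrow> (('v \<Rightarrow> real) \<Rightarrow> complex) \<Rightarrow> 'v cplx cdual" where
  "rho P k = (1/2) *\<^sub>C (\<Sum>\<alpha>\<in>P. k \<alpha> *\<^sub>C cplx_fun \<alpha>)"

end

theory Submission
  imports Defs
begin

text \<open>
  The degree zero component is computed by a Wick functional: the linear functional on words in
  \<open>V \<oplus> V\<^sup>*\<close> that sums, over all complete pairings, the products of the contractions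
  \<open>\<omega>(u\<^sub>i, u\<^sub>j) / 2\<close> with \<open>i < j\<close>. It respects the Weyl relations and, \<open>\<omega>\<close> being antisymmetric,
  vanishes on symmetrized words of positive length; as symmetrization is onto, this determines
  \<open>deg0\<close>. Since \<open>[s\<^sub>\<alpha>, s\<^sub>\<beta>] = \<alpha>(\<beta>\<^sup>\<or>) \<alpha>\<^sup>\<or> \<otimes> \<beta> - \<beta>(\<alpha>\<^sup>\<or>) \<beta>\<^sup>\<or> \<otimes> \<alpha>\<close>, the square of
  \<open>\<nu>'([s\<^sub>\<alpha>, s\<^sub>\<beta>])\<close> is a combination of words of length four, and its degree zero component is
  \<open>2 c - c\<^sup>2 / 2\<close> with \<open>c = \<alpha>(\<beta>\<^sup>\<or>) \<beta>(\<alpha>\<^sup>\<or>)\<close>. By invariance of \<open>B\<close>, \<open>c = 4 B(\<alpha>, \<beta>)\<^sup>2 / (B(\<alpha>, \<alpha>) B(\<beta>, \<beta>))\<close>,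
  and the claimed identity already holds for each pair of roots.
\<close>

section \<open>Complex-linear maps, spans and ideal hulls\<close>

lemma clinear_add: "clinear f \<Longrightarrow> f (x + y) = f x + f y"
  and clinear_scale: "clinear f \<Longrightarrow> f (c *\<^sub>C x) = c *\<^sub>C f x"
  by (simp_all add: clinear_iff)

lemma clinear_zero: "clinear f \<Longrightarrow> f 0 = 0"
  using clinear_scale[of f 0 0] by simp

lemma clinear_diff: "clinear f \<Longrightarrow> f (x - y) = f x - f y"
  using clinear_add[of f "x - y" y] by simp

lemma clinear_sum: "clinear f \<Longrightarrow> f (sum g S) = (\<Sum>x\<in>S. f (g x))"
  by (induction S rule: infinite_finite_induct) (simp_all add: clinear_zero clinear_add)

lemma clinear_compose: "clinear f \<Longrightarrow> clinear g \<Longrightarrow> clinear (\<lambda>x. g (f x))"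
  by (simp add: clinear_iff)

lemma clinear_zero_on_span:
  assumes "clinear f" "\<And>x. x \<in> S \<Longrightarrow> f x = 0" "x \<in> cvec.span S"
  shows "f x = 0"
  using assms(3)
proof (rule cvec.span_induct)
  show "cvec.subspace {x. f x = 0}"
    using assms(1) by (auto simp: cvec.subspace_def clinear_zero clinear_add clinear_scale)
qed (use assms(2) in simp)

lemma clinear_in_subspace:
  assumes "clinear f" "cvec.subspace R" "\<And>x. x \<in> S \<Longrightarrow> f x \<in> R" "x \<in> cvec.span S"
  shows "f x \<in> R"
  using assms(4)
proof (rule cvec.span_induct)
  show "cvec.subspace {x. f x \<in> R}"
    using assms(1,2) by (auto simp: cvec.subspace_def clinear_zero clinear_add clinear_scale)
qed (use assms(3) in simp)

text \<open>The elements \<open>x\<close> such that \<open>f\<close> kills every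
  \<open>a * x * b\<close> form a two-sided ideal containing \<open>S\<close>, hence containing the
  hull; then take \<open>a = b = 1\<close>.\<close>

lemma additive_kills_ideal_hull:
  fixes f :: "'r::{ring, monoid_mult} \<Rightarrow> 'x::ab_group_add"
  assumes add: "\<And>x y. f (x + y) = f x + f y"
    and kills: "\<And>a s b. s \<in> S \<Longrightarrow> f (a * s * b) = 0"
    and x: "x \<in> two_sided_ideal hull S"
  shows "f x = 0"
proof -
  define I where "I = {x. \<forall>a b. f (a * x * b) = 0}"
  have "f 0 = 0" using add[of 0 0] by simp
  then have "two_sided_ideal I"
    unfolding two_sided_ideal_def I_def
    by (auto simp: distrib_left distrib_right add mult.assoc)
       (simp add: mult.assoc[symmetric])+
  moreover have "S \<subseteq> I" by (auto simp: I_def kills)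
  ultimately have "two_sided_ideal hull S \<subseteq> I" by (rule hull_minimal[rotated])
  then have "f (1 * x * 1) = 0" using x unfolding I_def by blast
  then show ?thesis by simp
qed

section \<open>Linear maps out of the tensor, symmetric and Weyl algebras\<close>

text \<open>A function on words of all lengths at once: one multilinear map for each degree, which
  is exactly the data of a linear map out of the tensor algebra.\<close>

definition word_multilinear :: "('u::complex_vector list \<Rightarrow> 'x::complex_vector) \<Rightarrow> bool" where
  "word_multilinear g \<longleftrightarrow>
     (\<forall>xs u w ys. g (xs @ (u + w) # ys) = g (xs @ u # ys) + g (xs @ w # ys)) \<and>
     (\<forall>xs c u ys. g (xs @ (c *\<^sub>C u) # ys) = c *\<^sub>C g (xs @ u # ys))"

definition free_ext :: "('u list \<Rightarrow> 'x::complex_vector) \<Rightarrow> 'u free_alg \<Rightarrow> 'x" where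
  "free_ext g p = (\<Sum>w\<in>Poly_Mapping.keys p. Poly_Mapping.lookup p w *\<^sub>C g (letters w))"

lemma free_ext_eq_sum:
  assumes "finite A" "Poly_Mapping.keys p \<subseteq> A"
  shows "free_ext g p = (\<Sum>w\<in>A. Poly_Mapping.lookup p w *\<^sub>C g (letters w))"
  unfolding free_ext_def
  by (rule sum.mono_neutral_left) (use assms in \<open>auto simp: in_keys_iff\<close>)

lemma free_ext_add: "free_ext g (p + q) = free_ext g p + free_ext g q"
  using keys_add[of p q]
  by (simp add: free_ext_eq_sum[where A = "Poly_Mapping.keys p \<union> Poly_Mapping.keys q"]
      lookup_add scaleC_add_left sum.distrib)

lemma free_ext_single: "free_ext g (Poly_Mapping.single w c) = c *\<^sub>C g (letters w)"
  by (subst free_ext_eq_sum[where A = "{w}"]) (auto simp: lookup_single)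

lemma free_ext_diff: "free_ext g (p - q) = free_ext g p - free_ext g q"
  using free_ext_add[of g "p - q" q] by simp

lemma free_alg_induct [case_names single add]:
  assumes "\<And>w c. Q (Poly_Mapping.single w c)" "\<And>p q. Q p \<Longrightarrow> Q q \<Longrightarrow> Q (p + q)"
  shows "Q (p :: 'u free_alg)"
proof (induction p rule: update_induct)
  case const
  show ?case using assms(1)[of 0 0] by simp
next
  case (update f a b)
  have "Poly_Mapping.update a b f = f + Poly_Mapping.single a b"
    using update.hyps(1)
    by (intro poly_mapping_eqI)
       (auto simp: lookup_update lookup_add lookup_single in_keys_iff when_def)
  then show ?case using assms(1,2) update by simp
qed

lemma free_const_commute: "free_const c * p = p * free_const c"
  by (induction p rule: free_alg_induct)
     (simp_all add: mult_single distrib_left distrib_right mult.commute[of c])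

lemma free_ext_scale: "free_ext g (free_const c * p) = c *\<^sub>C free_ext g p"
  by (induction p rule: free_alg_induct)
     (simp_all add: mult_single distrib_left free_ext_add free_ext_single scaleC_scaleC
       scaleC_add_right)

text \<open>Both factors reduce to single words by additivity. The two kinds of relations then
  become additivity and homogeneity of \<open>g\<close> in the letter between those words.\<close>

lemma free_ext_kills_tensor_rels:
  assumes "word_multilinear g" "s \<in> tensor_rels"
  shows "free_ext g (p * s * q) = 0"
proof (induction p rule: free_alg_induct)
  case (single w c)
  show ?case
  proof (induction q rule: free_alg_induct)
    case (single w' c')
    obtain xs ys where w: "w = Word xs" "w' = Word ys" by (metis word_mon.exhaust)
    from assms(2) show ?case
      unfolding tensor_rels_def
    proof (elim UnE CollectE exE conjE)
      fix u v
      assume s: "s = free_gen (u + v) - (free_gen u + free_gen v)"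
      show ?thesis
        using assms(1) unfolding s w word_multilinear_def
        by (simp add: left_diff_distrib right_diff_distrib distrib_left distrib_right mult_single free_ext_diff free_ext_add
            free_ext_single plus_word_mon_def scaleC_add_right mult.assoc)
    next
      fix a u
      assume s: "s = free_gen (a *\<^sub>C u) - free_const a * free_gen u"
      show ?thesis
        using assms(1) unfolding s w word_multilinear_def
        by (simp add: left_diff_distrib right_diff_distrib distrib_left distrib_right mult_single free_ext_diff free_ext_add
            free_ext_single plus_word_mon_def zero_word_mon_def scaleC_scaleC mult.assoc mult.commute[of c' a])
    qed
  qed (simp add: distrib_left free_ext_add)
qed (simp add: distrib_right free_ext_add)

section \<open>Words span the tensor algebra, and multilinear functions lift to it\<close>

lemma abs_tensor_alg_single:
  "abs_tensor_alg (Poly_Mapping.single (Word us) c) = c *\<^sub>C prod_list (map tensor_vec us)"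
proof -
  have "abs_tensor_alg (Poly_Mapping.single (Word us) 1) = prod_list (map tensor_vec us)"
  proof (induction us)
    case Nil
    have "Poly_Mapping.single (Word []) 1 = (1 :: 'a free_alg)"
      by (simp add: single_one flip: zero_word_mon_def)
    then show ?case by (simp add: one_tensor_alg_def)
  next
    case (Cons u us)
    have "Poly_Mapping.single (Word (u # us)) (1::complex)
        = free_gen u * Poly_Mapping.single (Word us) 1"
      by (simp add: mult_single plus_word_mon_def)
    then show ?case
      using Cons by (simp add: tensor_vec.abs_eq times_tensor_alg.abs_eq[symmetric])
  qed
  moreover have "Poly_Mapping.single (Word us) c = free_const c * Poly_Mapping.single (Word us) 1"
    by (simp add: mult_single)
  ultimately show ?thesis by (simp add: scaleC_tensor_alg.abs_eq[symmetric])
qed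

lemma span_tensor_words: "cvec.span (range (\<lambda>us. prod_list (map tensor_vec us))) = UNIV"
proof -
  have "x \<in> cvec.span (range (\<lambda>us. prod_list (map tensor_vec us)))" for x :: "'a tensor_alg"
  proof (induction x rule: tensor_alg.abs_induct)
    case (1 p)
    show ?case
    proof (induction p rule: free_alg_induct)
      case (single w c)
      then show ?case
        by (cases w) (simp add: abs_tensor_alg_single cvec.span_scale cvec.span_base)
    next
      case (add p q)
      then show ?case
        by (simp add: plus_tensor_alg.abs_eq[symmetric] cvec.span_add)
    qed
  qed
  then show ?thesis by auto
qed

text \<open>The universal property for linear maps rather than algebra homomorphisms: the Wick
  functional is not multiplicative, so it has to be lifted as a family of multilinear maps.\<close>

lemma tensor_alg_lift:
  fixes g :: "'u::complex_vector list \<Rightarrow> 'x::complex_vector"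
  assumes "word_multilinear g"
  obtains G where "clinear G" "\<And>us. G (prod_list (map tensor_vec us)) = g us"
proof -
  \<comment> \<open>The value is read off from a chosen representative; \<open>eq\<close> shows that
    congruent representatives give the same value.\<close>
  define G where "G t = free_ext g (rep_tensor_alg t)" for t
  have eq: "free_ext g p = free_ext g q" if "ideal_cong tensor_rels p q" for p q
  proof -
    have "free_ext g (p - q) = 0"
      using additive_kills_ideal_hull[where f = "free_ext g" and S = tensor_rels and x = "p - q"]
        free_ext_add[of g]
        free_ext_kills_tensor_rels[OF assms] that
      by (auto simp: ideal_cong_def)
    then show ?thesis by (simp add: free_ext_diff)
  qed
  have G: "G (abs_tensor_alg p) = free_ext g p" for p
    unfolding G_def
    by (rule eq) (simp add: Quotient3_rep_abs[OF Quotient3_tensor_alg] ideal_cong_refl)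
  have "G (x + y) = G x + G y" for x y
    by (induction x; induction y)
       (simp add: plus_tensor_alg.abs_eq G free_ext_add)
  moreover have "G (c *\<^sub>C x) = c *\<^sub>C G x" for c x
    by (induction x) (simp add: scaleC_tensor_alg.abs_eq G free_ext_scale)
  ultimately have "clinear G" by (simp add: clinear_iff)
  moreover have "G (prod_list (map tensor_vec us)) = g us" for us
    using G[of "Poly_Mapping.single (Word us) 1"]
    by (simp add: abs_tensor_alg_single free_ext_single)
  ultimately show thesis by (rule that)
qed

text \<open>Scalars act by left multiplication with constants, so passing one across
  \<open>x\<close> uses that constants are central in the free algebra.\<close>

lemma tensor_alg_mult_scaleC: "x * (c *\<^sub>C y) = c *\<^sub>C (x * (y :: 'u::complex_vector tensor_alg))"
  proof (transfer, goal_cases)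
  case (1 x c y)
  have "x * (free_const c * y) = free_const c * (x * y)"
    by (simp add: mult.assoc[symmetric]) (simp add: free_const_commute)
  then show ?case by (simp add: ideal_cong_refl)
qed

text \<open>Words span the tensor algebra, so for a linear \<open>G\<close> it is enough to test the
  relations with a word on either side. This makes maps on the quotients well defined.\<close>

lemma clinear_kills_ideal_hull:
  fixes G :: "'u::complex_vector tensor_alg \<Rightarrow> 'x::complex_vector"
  assumes G: "clinear G"
    and kills: "\<And>xs s ys. s \<in> S \<Longrightarrow>
      G (prod_list (map tensor_vec xs) * s * prod_list (map tensor_vec ys)) = 0"
    and "ideal_cong S x y"
  shows "G x = G y"
proof -
  have "G (a * s * b) = 0" if s: "s \<in> S" for a s b
  proof -
    have 1: "G (prod_list (map tensor_vec xs) * s * b) = 0" for xs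
    proof (rule clinear_zero_on_span[where f = "\<lambda>b. G (prod_list (map tensor_vec xs) * s * b)"
          and S = "range (\<lambda>us. prod_list (map tensor_vec us))"])
      show "clinear (\<lambda>b. G (prod_list (map tensor_vec xs) * s * b))"
        using G by (simp add: clinear_iff distrib_left tensor_alg_mult_scaleC)
    qed (use kills[OF s] in \<open>auto simp: span_tensor_words\<close>)
    show ?thesis
    proof (rule clinear_zero_on_span[where f = "\<lambda>a. G (a * s * b)"
          and S = "range (\<lambda>us. prod_list (map tensor_vec us))"])
      show "clinear (\<lambda>a. G (a * s * b))"
        using G by (simp add: clinear_iff distrib_right scaleC_tensor_alg_mult)
    qed (use 1 in \<open>auto simp: span_tensor_words\<close>)
  qed
  then have "G (x - y) = 0"
    using additive_kills_ideal_hull[of G S "x - y"] assms(1,3)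
    by (auto simp: clinear_add ideal_cong_def)
  then show ?thesis using G by (simp add: clinear_diff)
qed

section \<open>Words and lifts for the symmetric and Weyl algebras\<close>

lemma abs_sym_alg_word: "abs_sym_alg (prod_list (map tensor_vec us)) = prod_list (map sym_vec us)"
  by (induction us)
     (simp_all add: one_sym_alg_def times_sym_alg.abs_eq[symmetric] sym_vec_def)

lemma abs_weyl_alg_word: "abs_weyl_alg (prod_list (map tensor_vec us)) = prod_list (map weyl_vec us)"
  by (induction us)
     (simp_all add: one_weyl_alg_def times_weyl_alg.abs_eq[symmetric] weyl_vec_def)

lemma clinear_abs_sym_alg: "clinear abs_sym_alg"
  by (simp add: clinear_iff plus_sym_alg.abs_eq scaleC_sym_alg.abs_eq)

lemma clinear_abs_weyl_alg: "clinear abs_weyl_alg"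
  by (simp add: clinear_iff plus_weyl_alg.abs_eq scaleC_weyl_alg.abs_eq)

lemma span_sym_words: "cvec.span (range (\<lambda>us. prod_list (map sym_vec us))) = UNIV"
proof -
  have "x \<in> cvec.span (range (\<lambda>us. prod_list (map sym_vec us)))" for x :: "'a sym_alg"
  proof (induction x rule: sym_alg.abs_induct)
    case (1 t)
    show ?case
      by (rule clinear_in_subspace[OF clinear_abs_sym_alg,
            of _ "range (\<lambda>us. prod_list (map tensor_vec us))"])
         (auto simp: span_tensor_words abs_sym_alg_word intro!: cvec.span_base)
  qed
  then show ?thesis by auto
qed

lemma span_weyl_words: "cvec.span (range (\<lambda>us. prod_list (map weyl_vec us))) = UNIV"
proof -
  have "x \<in> cvec.span (range (\<lambda>us. prod_list (map weyl_vec us)))" for x :: "'a weyl_alg"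
  proof (induction x rule: weyl_alg.abs_induct)
    case (1 t)
    show ?case
      by (rule clinear_in_subspace[OF clinear_abs_weyl_alg,
            of _ "range (\<lambda>us. prod_list (map tensor_vec us))"])
         (auto simp: span_tensor_words abs_weyl_alg_word intro!: cvec.span_base)
  qed
  then show ?thesis by auto
qed

text \<open>One formula serves both quotients: \<open>c = 0\<close> gives the relations of the
  symmetric algebra, \<open>c = symp_form a b\<close> those of the Weyl algebra.\<close>

lemma tensor_word_commutator:
  assumes "clinear G" "\<And>us. G (prod_list (map tensor_vec us)) = g us"
  shows "G (prod_list (map tensor_vec xs) * (tensor_vec a * tensor_vec b - tensor_vec b * tensor_vec a
      - c *\<^sub>C 1) * prod_list (map tensor_vec ys))
    = g (xs @ a # b # ys) - g (xs @ b # a # ys) - c *\<^sub>C g (xs @ ys)"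
  using assms(2)[of "xs @ a # b # ys"] assms(2)[of "xs @ b # a # ys"] assms(2)[of "xs @ ys"]
  by (simp add: algebra_simps clinear_diff[OF assms(1)] clinear_add[OF assms(1)]
      clinear_scale[OF assms(1)] tensor_alg_mult_scaleC scaleC_tensor_alg_mult)

lemma sym_alg_lift:
  fixes g :: "'u::complex_vector list \<Rightarrow> 'x::complex_vector"
  assumes "word_multilinear g" and swap: "\<And>xs a b ys. g (xs @ a # b # ys) = g (xs @ b # a # ys)"
  obtains G where "clinear G" "\<And>us. G (prod_list (map sym_vec us)) = g us"
proof -
  obtain T where T: "clinear T" "\<And>us. T (prod_list (map tensor_vec us)) = g us"
    using tensor_alg_lift[OF assms(1)] by metis
  define G where "G x = T (rep_sym_alg x)" for x
  have "T x = T y" if "ideal_cong sym_rels x y" for x y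
    using T(1) _ that
  proof (rule clinear_kills_ideal_hull)
    fix xs s ys
    assume "s \<in> (sym_rels :: 'u tensor_alg set)"
    then show "T (prod_list (map tensor_vec xs) * s * prod_list (map tensor_vec ys)) = 0"
      using tensor_word_commutator[OF T, of xs _ _ 0 ys] swap by (auto simp: sym_rels_def)
  qed
  then have G: "G (abs_sym_alg t) = T t" for t
    unfolding G_def
    by (simp add: Quotient3_rep_abs[OF Quotient3_sym_alg] ideal_cong_refl)
  have "G (x + y) = G x + G y" for x y
    by (induction x; induction y) (simp add: plus_sym_alg.abs_eq G clinear_add[OF T(1)])
  moreover have "G (c *\<^sub>C x) = c *\<^sub>C G x" for c x
    by (induction x) (simp add: scaleC_sym_alg.abs_eq G clinear_scale[OF T(1)])
  ultimately have "clinear G" by (simp add: clinear_iff)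
  moreover have "G (prod_list (map sym_vec us)) = g us" for us
    by (simp add: G T(2) flip: abs_sym_alg_word)
  ultimately show thesis by (rule that)
qed

lemma weyl_alg_lift:
  fixes g :: "('u::complex_vector \<times> 'u cdual) list \<Rightarrow> 'x::complex_vector"
  assumes "word_multilinear g"
    and swap: "\<And>xs a b ys. g (xs @ a # b # ys) - g (xs @ b # a # ys) = symp_form a b *\<^sub>C g (xs @ ys)"
  obtains G where "clinear G" "\<And>us. G (prod_list (map weyl_vec us)) = g us"
proof -
  obtain T where T: "clinear T" "\<And>us. T (prod_list (map tensor_vec us)) = g us"
    using tensor_alg_lift[OF assms(1)] by metis
  define G where "G x = T (rep_weyl_alg x)" for x
  have "T x = T y" if "ideal_cong weyl_rels x y" for x y
    using T(1) _ that
  proof (rule clinear_kills_ideal_hull)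
    fix xs s ys
    assume "s \<in> (weyl_rels :: ('u \<times> 'u cdual) tensor_alg set)"
    then show "T (prod_list (map tensor_vec xs) * s * prod_list (map tensor_vec ys)) = 0"
      using tensor_word_commutator[OF T, of xs _ _ _ ys] swap by (auto simp: weyl_rels_def)
  qed
  then have G: "G (abs_weyl_alg t) = T t" for t
    unfolding G_def
    by (simp add: Quotient3_rep_abs[OF Quotient3_weyl_alg] ideal_cong_refl)
  have "G (x + y) = G x + G y" for x y
    by (induction x; induction y) (simp add: plus_weyl_alg.abs_eq G clinear_add[OF T(1)])
  moreover have "G (c *\<^sub>C x) = c *\<^sub>C G x" for c x
    by (induction x) (simp add: scaleC_weyl_alg.abs_eq G clinear_scale[OF T(1)])
  ultimately have "clinear G" by (simp add: clinear_iff)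
  moreover have "G (prod_list (map weyl_vec us)) = g us" for us
    by (simp add: G T(2) flip: abs_weyl_alg_word)
  ultimately show thesis by (rule that)
qed

section \<open>The Wick functional\<close>

text \<open>The sum over complete pairings, expanded along the partner of the first letter. Words of
  odd length receive the value 0, as the expansion ends in a one-letter word with an empty
  sum.\<close>

fun wick :: "('u::complex_vector \<times> 'u cdual) list \<Rightarrow> complex" where
  "wick [] = 1"
| "wick (u # us) =
    (\<Sum>i<length us. 1/2 * symp_form u (us ! i) * wick (take i us @ drop (Suc i) us))"

text \<open>The same sum over partners of \<open>u\<close>, in structural form: \<open>h\<close> is
  applied to the word left after the partner is removed. Letters already passed are absorbed into
  \<open>h\<close>, so inductions and splittings at an append become possible.\<close>

primrec contract ::
  "'u::complex_vector \<times> 'u cdual \<Rightarrow> (('u \<times> 'u cdual) list \<Rightarrow> complex) \<Rightarrow> ('u \<times> 'u cdual) list \<Rightarrow> complex"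
where
  "contract u h [] = 0"
| "contract u h (y # ys) = 1/2 * symp_form u y * h ys + contract u (\<lambda>zs. h (y # zs)) ys"

lemma symp_form_add_left: "symp_form (a + b) c = symp_form a c + symp_form b c"
  and symp_form_add_right: "symp_form c (a + b) = symp_form c a + symp_form c b"
  and symp_form_scale_left: "symp_form (x *\<^sub>C a) c = x * symp_form a c"
  and symp_form_scale_right: "symp_form c (x *\<^sub>C a) = x * symp_form c a"
  using ev[of "snd c"] ev[of "snd a"] ev[of "snd b"]
  by (simp_all add: symp_form_def clinear_iff scaleC_prod_def plus_cdual.rep_eq scaleC_cdual.rep_eq
      scaleC_complex_def algebra_simps)

lemma symp_form_swap: "symp_form b a = - symp_form a b"
  by (simp add: symp_form_def)

lemma contract_eq_sum:
  "(\<Sum>i<length us. 1/2 * symp_form u (us ! i) * h (take i us @ drop (Suc i) us)) = contract u h us"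
  by (induction us arbitrary: h) (simp_all del: sum.lessThan_Suc add: sum.lessThan_Suc_shift)

lemma wick_Cons: "wick (u # us) = contract u wick us"
  using contract_eq_sum[of u us wick] by simp

text \<open>Removing a partner shortens the word; this is what lets an induction hypothesis on
  length be used under \<open>contract\<close>.\<close>

lemma contract_cong:
  "(\<And>zs. length zs < length us \<Longrightarrow> h zs = h' zs) \<Longrightarrow> contract u h us = contract u h' us"
proof (induction us arbitrary: h h')
  case (Cons y us)
  have "h us = h' us" by (rule Cons.prems) simp
  moreover have "contract u (\<lambda>zs. h (y # zs)) us = contract u (\<lambda>zs. h' (y # zs)) us"
    by (rule Cons.IH, rule Cons.prems) simp
  ultimately show ?case by simp
qed simp

lemma contract_append:
  "contract u h (xs @ ys) = contract u (\<lambda>z. h (z @ ys)) xs + contract u (\<lambda>z. h (xs @ z)) ys"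
  by (induction xs arbitrary: h) (simp_all add: add.assoc)

lemma contract_add: "contract u (\<lambda>z. h z + h' z) us = contract u h us + contract u h' us"
  by (induction us arbitrary: h h') (simp_all add: algebra_simps)

lemma contract_scale: "contract u (\<lambda>z. c * h z) us = c * contract u h us"
  by (induction us arbitrary: h) (simp_all add: algebra_simps)

lemma contract_diff: "contract u (\<lambda>z. h z - h' z) us = contract u h us - contract u h' us"
  using contract_add[of u "\<lambda>z. h z - h' z" h' us] by simp

lemma contract_add_vec: "contract (u + v) h us = contract u h us + contract v h us"
  by (induction us arbitrary: h) (simp_all add: symp_form_add_left algebra_simps)

lemma contract_scale_vec: "contract (c *\<^sub>C u) h us = c * contract u h us"
  by (induction us arbitrary: h) (simp_all add: symp_form_scale_left algebra_simps)

text \<open>Both sides sum over ordered pairs of distinct positions, one partner for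
  \<open>a\<close> and one for \<open>b\<close>; the order of choosing them is immaterial.\<close>

lemma contract_commute: "contract a (contract b h) us = contract b (contract a h) us"
proof (induction us arbitrary: h)
  case (Cons y us)
  show ?case
    by (simp only: contract.simps contract_add contract_scale Cons.IH) simp
qed simp

text \<open>When another letter \<open>x\<close> comes first, its partner lies to the left of the
  distinguished letter, to the right of it, or is that letter. The first two cases follow by
  induction on the length, the third by linearity of \<open>symp_form\<close>.\<close>

lemma wick_add:
  "wick (xs @ (u + v) # ys) = wick (xs @ u # ys) + wick (xs @ v # ys)"
proof (induction "length xs + length ys" arbitrary: xs ys rule: less_induct)
  case less
  show ?case
  proof (cases xs)
    case Nil
    then show ?thesis by (simp add: wick_Cons contract_add_vec del: wick.simps)
  next
    case (Cons x xs')
    have 1: "contract x (\<lambda>z. wick (z @ (u + v) # ys)) xs'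
        = contract x (\<lambda>z. wick (z @ u # ys) + wick (z @ v # ys)) xs'"
      by (rule contract_cong, rule less) (simp add: Cons)
    have 2: "contract x (\<lambda>z. wick (xs' @ (u + v) # z)) ys
        = contract x (\<lambda>z. wick (xs' @ u # z) + wick (xs' @ v # z)) ys"
      by (rule contract_cong, rule less) (simp add: Cons)
    show ?thesis
      by (simp add: Cons wick_Cons contract_append 1 2 contract_add symp_form_add_right
          algebra_simps del: wick.simps)
  qed
qed

lemma wick_scale: "wick (xs @ (c *\<^sub>C u) # ys) = c * wick (xs @ u # ys)"
proof (induction "length xs + length ys" arbitrary: xs ys rule: less_induct)
  case less
  show ?case
  proof (cases xs)
    case Nil
    then show ?thesis by (simp add: wick_Cons contract_scale_vec del: wick.simps)
  next
    case (Cons x xs')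
    have 1: "contract x (\<lambda>z. wick (z @ (c *\<^sub>C u) # ys)) xs'
        = contract x (\<lambda>z. c * wick (z @ u # ys)) xs'"
      by (rule contract_cong, rule less) (simp add: Cons)
    have 2: "contract x (\<lambda>z. wick (xs' @ (c *\<^sub>C u) # z)) ys
        = contract x (\<lambda>z. c * wick (xs' @ u # z)) ys"
      by (rule contract_cong, rule less) (simp add: Cons)
    show ?thesis
      by (simp add: Cons wick_Cons contract_append 1 2 contract_scale symp_form_scale_right
          algebra_simps del: wick.simps)
  qed
qed

lemma word_multilinear_wick: "word_multilinear wick"
  by (simp add: word_multilinear_def wick_add wick_scale scaleC_complex_def)

text \<open>At the head of the word, pairing \<open>a\<close> with \<open>b\<close> contributes half
  of \<open>symp_form a b\<close> in one order and its negative in the other, so the difference is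
  the full form; the remaining pairings agree by \<open>contract_commute\<close>. Behind a first
  letter \<open>x\<close>, the contractions of \<open>x\<close> with \<open>a\<close> or
  \<open>b\<close> cancel and the others follow by induction.\<close>

lemma wick_commutator:
  "wick (xs @ a # b # ys) - wick (xs @ b # a # ys) = symp_form a b * wick (xs @ ys)"
proof (induction "length xs + length ys" arbitrary: xs ys rule: less_induct)
  case less
  show ?case
  proof (cases xs)
    case Nil
    have "wick (u # v # ys) = 1/2 * symp_form u v * wick ys + contract u (contract v wick) ys" for u v
      by (simp add: wick_Cons del: wick.simps)
    then show ?thesis
      by (simp add: Nil contract_commute[of a b] symp_form_swap[of b a] algebra_simps
          del: wick.simps)
  next
    case (Cons x xs')
    have 1: "contract x (\<lambda>z. wick (z @ a # b # ys) - wick (z @ b # a # ys)) xs'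
        = contract x (\<lambda>z. symp_form a b * wick (z @ ys)) xs'"
      by (rule contract_cong, rule less) (simp add: Cons)
    have 2: "contract x (\<lambda>z. wick (xs' @ a # b # z) - wick (xs' @ b # a # z)) ys
        = contract x (\<lambda>z. symp_form a b * wick (xs' @ z)) ys"
      by (rule contract_cong, rule less) (simp add: Cons)
    show ?thesis
      using 1 2
      by (simp add: Cons wick_Cons contract_append contract_diff contract_scale
          algebra_simps del: wick.simps)
  qed
qed

section \<open>Symmetrized words\<close>

text \<open>The average is taken for an arbitrary function on words, so that it can be applied both
  to products in the Weyl algebra and to the values of \<open>wick\<close>.\<close>

definition symmetrize :: "('u list \<Rightarrow> 'x::complex_vector) \<Rightarrow> 'u list \<Rightarrow> 'x" where
  "symmetrize h us = (1 / fact (length us)) *\<^sub>C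
     (\<Sum>\<sigma> | \<sigma> permutes {..<length us}. h (permute_list \<sigma> us))"

text \<open>The place to which a permutation moves a given letter, and all letters around it, do not
  depend on that letter. Hence \<open>as\<close> and \<open>bs\<close> are chosen before
  \<open>x\<close>, which is what multilinearity of the average requires.\<close>

lemma permute_list_split:
  assumes "\<sigma> permutes {..<Suc (length xs + length ys)}"
  obtains as bs where "\<And>x. permute_list \<sigma> (xs @ x # ys) = as @ x # bs"
proof -
  let ?n = "Suc (length xs + length ys)"
  obtain q where q: "\<sigma> q = length xs" using permutes_surj[OF assms] by (metis surjD)
  then have "q < ?n" using permutes_in_image[OF assms, of q] by simp
  then have upt: "[0..<?n] = [0..<q] @ q # [Suc q..<?n]"
    by (metis upt_add_eq_append upt_conv_Cons le_add_diff_inverse less_imp_le_nat add_0 zero_le)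
  \<comment> \<open>\<open>undefined\<close> is a placeholder at position \<open>length xs\<close>;
    it is never read, since \<open>f\<close> is used only at indices other than
    \<open>q\<close>.\<close>
  define f where "f i = (xs @ undefined # ys) ! \<sigma> i" for i
  have "permute_list \<sigma> (xs @ x # ys) = map f [0..<q] @ x # map f [Suc q..<?n]" for x
  proof -
    have "(xs @ x # ys) ! \<sigma> i = f i" if "i \<noteq> q" for i
    proof -
      have "\<sigma> i \<noteq> length xs" using that q permutes_inj[OF assms] by (metis injD)
      then show ?thesis by (auto simp: f_def nth_append nth_Cons split: nat.split)
    qed
    then show ?thesis using q by (simp add: permute_list_def upt del: upt_Suc)
  qed
  then show thesis by (rule that)
qed

lemma word_multilinear_symmetrize:
  assumes "word_multilinear h"
  shows "word_multilinear (symmetrize h)"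
proof -
  have add: "h (permute_list \<sigma> (xs @ (u + w) # ys))
      = h (permute_list \<sigma> (xs @ u # ys)) + h (permute_list \<sigma> (xs @ w # ys))"
    and scale: "h (permute_list \<sigma> (xs @ (c *\<^sub>C u) # ys)) = c *\<^sub>C h (permute_list \<sigma> (xs @ u # ys))"
    if "\<sigma> permutes {..<Suc (length xs + length ys)}" for \<sigma> xs ys c u w
    using permute_list_split[OF that] assms unfolding word_multilinear_def by metis+
  show ?thesis
    unfolding word_multilinear_def symmetrize_def
    by (auto simp: add scale sum.distrib scaleC_add_right cvec.scale_sum_right scaleC_scaleC
        mult.commute)
qed

lemma symmetrize_permute_list:
  assumes "\<tau> permutes {..<length us}"
  shows "symmetrize h (permute_list \<tau> us) = symmetrize h us"
proof -
  have "(\<Sum>\<sigma> | \<sigma> permutes {..<length us}. h (permute_list \<sigma> (permute_list \<tau> us)))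
      = (\<Sum>\<sigma> | \<sigma> permutes {..<length us}. h (permute_list (\<tau> \<circ> \<sigma>) us))"
    by (rule sum.cong) (simp_all add: permute_list_compose)
  also have "\<dots> = (\<Sum>\<sigma> | \<sigma> permutes {..<length us}. h (permute_list \<sigma> us))"
    by (rule setum_permutations_compose_left[OF assms, symmetric])
  finally show ?thesis by (simp add: symmetrize_def)
qed

text \<open>The block \<open>ys\<close> between the exchanged letters covers two uses: it is empty
  for adjacent letters, and arbitrary when the first letter is exchanged with its partner in a
  contraction.\<close>

lemma permute_list_transpose:
  "permute_list (Transposition.transpose (length xs) (Suc (length xs + length ys))) (xs @ a # ys @ b # zs)
    = xs @ b # ys @ a # zs"
  (is "permute_list ?t ?L = ?R")
proof (rule nth_equalityI)
  fix i assume i: "i < length (permute_list ?t ?L)"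
  have "permute_list ?t ?L ! i = ?L ! ?t i"
    using i by (simp add: permute_list_def del: upt_Suc)
  also consider "i < length xs" | "i = length xs"
    | "length xs < i" "i < Suc (length xs + length ys)"
    | "i = Suc (length xs + length ys)" | "Suc (length xs + length ys) < i"
    by linarith
  then have "?L ! ?t i = ?R ! i"
  proof cases
    case 1
    then show ?thesis by (simp add: nth_append transpose_def)
  next
    case 2
    then show ?thesis by (simp add: nth_append)
  next
    case 3
    then obtain j where "i = Suc (length xs + j)" by (metis less_imp_Suc_add)
    then show ?thesis using 3 by (simp add: nth_append transpose_def)
  next
    case 4
    then show ?thesis by (simp add: nth_append)
  next
    case 5
    then obtain j where "i = Suc (Suc (length xs + length ys) + j)" by (metis less_imp_Suc_add)
    then show ?thesis by (simp add: nth_append transpose_def)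
  qed
  finally show "permute_list ?t ?L ! i = ?R ! i" .
qed simp

lemma symmetrize_swap: "symmetrize h (xs @ a # b # ys) = symmetrize h (xs @ b # a # ys)"
proof -
  let ?t = "Transposition.transpose (length xs) (Suc (length xs))"
  have "permute_list ?t (xs @ b # a # ys) = xs @ a # b # ys"
    using permute_list_transpose[of xs "[]"] by simp
  moreover have "?t permutes {..<length (xs @ b # a # ys)}"
    by (rule permutes_swap_id) simp_all
  ultimately show ?thesis using symmetrize_permute_list by metis
qed

text \<open>Exchanging the first letter with the one it is contracted with changes the sign of the
  contraction and preserves the remaining word.\<close>

lemma symmetrize_wick:
  fixes us :: "('u::complex_vector \<times> 'u cdual) list"
  assumes "us \<noteq> []"
  shows "symmetrize wick us = 0"
proof -
  define n where "n = length us - 1"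
  have len: "length us = Suc n" using assms by (cases us) (simp_all add: n_def)
  \<comment> \<open>The term of \<open>wick L\<close> in which the first letter is contracted with
    the letter at position \<open>Suc i\<close>; the shift arises because \<open>i\<close> counts
    positions in the tail.\<close>
  define F where "F L i = 1/2 * symp_form (L ! 0) (L ! Suc i)
      * wick (take i (tl L) @ drop (Suc i) (tl L))" for L :: "('u \<times> 'u cdual) list" and i
  have wick: "wick L = (\<Sum>i<n. F L i)" if "length L = Suc n" for L
    using that by (cases L) (simp_all add: F_def)
  have "(\<Sum>\<sigma> | \<sigma> permutes {..<Suc n}. F (permute_list \<sigma> us) i) = 0" if i: "i < n" for i
  proof -
    let ?t = "Transposition.transpose 0 (Suc i)"
    have t: "?t permutes {..<Suc n}" by (rule permutes_swap_id) (use i in auto)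
    have flip: "F (permute_list ?t L) i = - F L i" if L: "length L = Suc n" for L
    proof -
      obtain x L' where "L = x # L'" using L by (cases L) auto
      moreover define as y bs where "as = take i L'" and "y = L' ! i" and "bs = drop (Suc i) L'"
      ultimately have L': "L = x # as @ y # bs" "length as = i"
        using L i id_take_nth_drop[of i L'] by simp_all
      have p: "permute_list ?t (x # as @ y # bs) = y # as @ x # bs"
        using permute_list_transpose[of "[]" as x y bs] L'(2) by simp
      have F: "F (u # as @ v # bs) i = 1/2 * symp_form u v * wick (as @ bs)" for u v
        by (simp add: F_def L'(2)[symmetric] del: wick.simps)
      show ?thesis
        unfolding L'(1) p F by (simp add: symp_form_swap[of x y] del: wick.simps)
    qed
    \<comment> \<open>Reindexing by right composition with the transposition shows that the sum
      equals its own negative.\<close>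
    have "(\<Sum>\<sigma> | \<sigma> permutes {..<Suc n}. F (permute_list \<sigma> us) i)
        = (\<Sum>\<sigma> | \<sigma> permutes {..<Suc n}. F (permute_list (\<sigma> \<circ> ?t) us) i)"
      by (rule sum_permutations_compose_right[OF t])
    also have "\<dots> = (\<Sum>\<sigma> | \<sigma> permutes {..<Suc n}. - F (permute_list \<sigma> us) i)"
      using t by (intro sum.cong) (simp_all add: permute_list_compose flip len)
    finally show ?thesis by (simp add: sum_negf)
  qed
  then have "(\<Sum>i<n. \<Sum>\<sigma> | \<sigma> permutes {..<Suc n}. F (permute_list \<sigma> us) i) = 0" by simp
  then show ?thesis
    by (subst (asm) sum.swap) (simp add: symmetrize_def wick len)
qed

section \<open>The symmetrization map and the degree zero component\<close>

lemma weyl_alg_scaleC_mult: "(c *\<^sub>C x) * y = c *\<^sub>C (x * (y :: 'u::complex_vector weyl_alg))"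
  by transfer (simp add: scaleC_tensor_alg_mult ideal_cong_refl)

lemma weyl_alg_mult_scaleC: "x * (c *\<^sub>C y) = c *\<^sub>C (x * (y :: 'u::complex_vector weyl_alg))"
  by transfer (simp add: tensor_alg_mult_scaleC ideal_cong_refl)

lemma weyl_vec_add: "weyl_vec (a + b) = weyl_vec a + weyl_vec b"
proof -
  have "tensor_vec (a + b) = tensor_vec a + tensor_vec b"
  proof (transfer, goal_cases)
    case (1 a b)
    show ?case
      unfolding ideal_cong_def
      by (rule hull_inc, unfold tensor_rels_def) blast
  qed
  then show ?thesis by (simp add: weyl_vec_def plus_weyl_alg.abs_eq)
qed

lemma weyl_vec_scale: "weyl_vec (c *\<^sub>C a) = c *\<^sub>C weyl_vec a"
proof -
  have "tensor_vec (c *\<^sub>C a) = c *\<^sub>C tensor_vec a"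
  proof (transfer, goal_cases)
    case (1 c a)
    show ?case
      unfolding ideal_cong_def
      by (rule hull_inc, unfold tensor_rels_def) blast
  qed
  then show ?thesis by (simp add: weyl_vec_def scaleC_weyl_alg.abs_eq)
qed

lemma clinear_weyl_vec: "clinear weyl_vec"
  by (simp add: clinear_iff weyl_vec_add weyl_vec_scale)

lemma weyl_vec_commutator:
  "weyl_vec a * weyl_vec b - weyl_vec b * weyl_vec a = symp_form a b *\<^sub>C 1"
proof -
  have "ideal_cong weyl_rels (tensor_vec a * tensor_vec b - tensor_vec b * tensor_vec a)
      (symp_form a b *\<^sub>C 1)"
    unfolding ideal_cong_def by (rule hull_inc, unfold weyl_rels_def) blast
  then have "abs_weyl_alg (tensor_vec a * tensor_vec b - tensor_vec b * tensor_vec a)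
      = abs_weyl_alg (symp_form a b *\<^sub>C 1)"
    by (simp add: weyl_alg.abs_eq_iff)
  then show ?thesis
    by (simp add: weyl_vec_def one_weyl_alg_def times_weyl_alg.abs_eq minus_weyl_alg.abs_eq
        scaleC_weyl_alg.abs_eq)
qed

section \<open>Existence, uniqueness and surjectivity of symmetrization\<close>

definition weyl_word :: "('u::complex_vector \<times> 'u cdual) list \<Rightarrow> 'u weyl_alg" where
  "weyl_word us = prod_list (map weyl_vec us)"

lemma word_multilinear_weyl_word: "word_multilinear weyl_word"
  by (simp add: word_multilinear_def weyl_word_def weyl_vec_add weyl_vec_scale weyl_alg_scaleC_mult
      weyl_alg_mult_scaleC distrib_left distrib_right)

lemma weyl_word_commutator:
  "weyl_word (xs @ a # b # ys) - weyl_word (xs @ b # a # ys) = symp_form a b *\<^sub>C weyl_word (xs @ ys)"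
proof -
  have "weyl_word (xs @ a # b # ys) - weyl_word (xs @ b # a # ys)
      = weyl_word xs * (weyl_vec a * weyl_vec b - weyl_vec b * weyl_vec a) * weyl_word ys"
    by (simp add: weyl_word_def algebra_simps)
  then show ?thesis
    by (simp add: weyl_vec_commutator weyl_alg_mult_scaleC weyl_alg_scaleC_mult)
       (simp add: weyl_word_def)
qed

lemma symmetrization_exists:
  "\<exists>Q :: ('u::complex_vector \<times> 'u cdual) sym_alg \<Rightarrow> 'u weyl_alg.
     clinear Q \<and> (\<forall>us. Q (prod_list (map sym_vec us)) = symmetrize weyl_word us)"
proof -
  obtain Q where "clinear Q"
    "\<And>us. Q (prod_list (map sym_vec us)) = (symmetrize weyl_word us :: 'u weyl_alg)"
    using sym_alg_lift[OF word_multilinear_symmetrize[OF word_multilinear_weyl_word]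
        symmetrize_swap] by metis
  then show ?thesis by metis
qed

lemma symmetrize_weyl_word:
  "symmetrize weyl_word us = (1 / fact (length us)) *\<^sub>C
     (\<Sum>\<sigma> | \<sigma> permutes {..<length us}. prod_list (map (\<lambda>i. weyl_vec (us ! \<sigma> i)) [0..<length us]))"
  by (simp add: symmetrize_def weyl_word_def permute_list_def comp_def)

text \<open>Existence comes from lifting the averages, which adjacent swaps leave unchanged;
  uniqueness holds because words span. Together they give meaning to the definite description of
  \<open>symmetrization\<close>.\<close>

lemma symmetrization_unique:
  "\<exists>!Q :: ('u::complex_vector \<times> 'u cdual) sym_alg \<Rightarrow> 'u weyl_alg.
     clinear Q \<and> (\<forall>us. Q (prod_list (map sym_vec us)) = symmetrize weyl_word us)"
proof -
  let ?P = "\<lambda>Q :: ('u \<times> 'u cdual) sym_alg \<Rightarrow> 'u weyl_alg.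
    clinear Q \<and> (\<forall>us. Q (prod_list (map sym_vec us)) = symmetrize weyl_word us)"
  show ?thesis
  proof (rule ex_ex1I)
    show "\<exists>Q. ?P Q" by (rule symmetrization_exists)
    fix Q R assume Q: "?P Q" and R: "?P R"
    show "Q = R"
    proof
      fix x
      have "Q x - R x = 0"
      proof (rule clinear_zero_on_span[where f = "\<lambda>x. Q x - R x"
            and S = "range (\<lambda>us. prod_list (map sym_vec us))"])
        show "clinear (\<lambda>x. Q x - R x)"
          using Q R by (simp add: clinear_iff cvec.scale_right_diff_distrib)
      qed (use Q R in \<open>auto simp: span_sym_words\<close>)
      then show "Q x = R x" by simp
    qed
  qed
qed

lemma symmetrization_eq:
  "symmetrization = (THE Q. clinear Q \<and> (\<forall>us. Q (prod_list (map sym_vec us)) = symmetrize weyl_word us))"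
  by (simp only: symmetrization_def symmetrize_weyl_word)

lemma clinear_symmetrization: "clinear symmetrization"
  using theI'[OF symmetrization_unique] unfolding symmetrization_eq by blast

lemma symmetrization_word: "symmetrization (prod_list (map sym_vec us)) = symmetrize weyl_word us"
  using theI'[OF symmetrization_unique] unfolding symmetrization_eq by blast

text \<open>Words with the same letters are joined by adjacent swaps, each of which changes
  \<open>f\<close> by an element of \<open>R\<close>. The length is fixed to \<open>n\<close>
  because the application controls swaps only in words of one length; letters already in place
  collect in the prefix \<open>ps\<close>.\<close>

lemma diff_in_subspace_if_mset_eq:
  fixes f :: "'u list \<Rightarrow> 'x::complex_vector"
  assumes R: "cvec.subspace R"
    and swap: "\<And>ps a b qs. length ps + length qs + 2 = n \<Longrightarrow>
      f (ps @ a # b # qs) - f (ps @ b # a # qs) \<in> R"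
    and "mset xs = mset ys" "length ps + length xs = n"
  shows "f (ps @ xs) - f (ps @ ys) \<in> R"
proof -
  have move: "f (ps @ as @ x # bs) - f (ps @ x # as @ bs) \<in> R"
    if "length ps + length as + length bs + 1 = n" for ps as bs x
    using that
  proof (induction as arbitrary: ps)
    case Nil
    then show ?case using R by (simp add: cvec.subspace_0)
  next
    case (Cons a as)
    have "f ((ps @ [a]) @ as @ x # bs) - f ((ps @ [a]) @ x # as @ bs) \<in> R"
      using Cons.prems by (intro Cons.IH) simp
    moreover have "f (ps @ a # x # as @ bs) - f (ps @ x # a # as @ bs) \<in> R"
      using Cons.prems by (intro swap) simp
    ultimately show ?case using cvec.subspace_add[OF R] by fastforce
  qed
  show ?thesis
    using assms(3,4)
  proof (induction xs arbitrary: ps ys)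
    case Nil
    then show ?case using R by (simp add: cvec.subspace_0)
  next
    case (Cons x xs)
    have "x \<in> set ys" using Cons.prems(1) by (metis list.set_intros(1) set_mset_mset)
    then obtain as bs where ys: "ys = as @ x # bs" by (meson split_list)
    have len: "length xs = length as + length bs"
      using mset_eq_length[OF Cons.prems(1)] ys by simp
    have "f ((ps @ [x]) @ xs) - f ((ps @ [x]) @ as @ bs) \<in> R"
      using Cons.prems ys by (intro Cons.IH) auto
    moreover have "f (ps @ as @ x # bs) - f (ps @ x # as @ bs) \<in> R"
      using Cons.prems len by (intro move) simp
    ultimately show ?case using cvec.subspace_diff[OF R] ys by fastforce
  qed
qed

text \<open>Induction on the length of words: an adjacent swap changes a word by a multiple of a
  word two letters shorter, which is in the range already. So a word differs from the average of its
  rearrangements by an element of the range, and that average is itself a value of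
  \<open>symmetrization\<close>.\<close>

lemma surj_symmetrization:
  "surj (symmetrization :: ('u::complex_vector \<times> 'u cdual) sym_alg \<Rightarrow> 'u weyl_alg)"
proof -
  let ?R = "range symmetrization :: 'u weyl_alg set"
  have R: "cvec.subspace ?R"
    unfolding cvec.subspace_def
    by (auto simp: clinear_zero[OF clinear_symmetrization, symmetric]
        clinear_add[OF clinear_symmetrization, symmetric]
        clinear_scale[OF clinear_symmetrization, symmetric] intro: range_eqI)
  have word: "weyl_word us \<in> ?R" for us :: "('u \<times> 'u cdual) list"
  proof (induction "length us" arbitrary: us rule: less_induct)
    case less
    let ?S = "{\<sigma>. \<sigma> permutes {..<length us}}"
    have "weyl_word us - weyl_word (permute_list \<sigma> us) \<in> ?R" if "\<sigma> \<in> ?S" for \<sigma>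
    proof -
      have "weyl_word ([] @ us) - weyl_word ([] @ permute_list \<sigma> us) \<in> ?R"
      proof (rule diff_in_subspace_if_mset_eq[OF R, where n = "length us"])
        fix ps qs :: "('u \<times> 'u cdual) list" and a b
        assume "length ps + length qs + 2 = length us"
        then have "weyl_word (ps @ qs) \<in> ?R" by (intro less) simp
        then show "weyl_word (ps @ a # b # qs) - weyl_word (ps @ b # a # qs) \<in> ?R"
          by (simp add: weyl_word_commutator cvec.subspace_scale[OF R])
      qed (use that in simp_all)
      then show ?thesis by simp
    qed
    then have "(1 / fact (length us)) *\<^sub>C (\<Sum>\<sigma>\<in>?S. weyl_word us - weyl_word (permute_list \<sigma> us)) \<in> ?R"
      by (intro cvec.subspace_scale[OF R] cvec.subspace_sum[OF R]) auto
    \<comment> \<open>There are \<open>fact (length us)\<close> permutations, so the average of a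
      constant is that constant.\<close>
    moreover have "(1 / fact (length us)) *\<^sub>C (\<Sum>\<sigma>\<in>?S. weyl_word us) = weyl_word us"
      by (simp add: cvec.sum_constant_scale card_permutations[OF refl] scaleC_scaleC scaleC_one)
    ultimately have "weyl_word us - symmetrize weyl_word us \<in> ?R"
      by (simp add: sum_subtractf cvec.scale_right_diff_distrib symmetrize_def)
    moreover have "symmetrize weyl_word us \<in> ?R"
      unfolding symmetrization_word[symmetric] by (rule rangeI)
    ultimately have "weyl_word us - symmetrize weyl_word us + symmetrize weyl_word us \<in> ?R"
      by (rule cvec.subspace_add[OF R])
    then show ?case by simp
  qed
  have "x \<in> ?R" for x
  proof (rule clinear_in_subspace[where f = "\<lambda>x. x" and S = "range weyl_word", OF _ R])
    show "clinear (\<lambda>x :: 'u weyl_alg. x)" by (simp add: clinear_iff)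
    show "x \<in> cvec.span (range weyl_word)"
      using span_weyl_words unfolding weyl_word_def by blast
  qed (use word in auto)
  then show ?thesis by auto
qed

text \<open>Such an \<epsilon> kills the span of all positive degrees but not 1, so the constant in
  the definite description is unique; it exists because words span. The required direct sum
  decomposition thus comes from the functional itself.\<close>

lemma sym_deg0_eq:
  fixes \<epsilon> :: "'u::complex_vector sym_alg \<Rightarrow> complex"
  assumes \<epsilon>: "clinear \<epsilon>" "\<epsilon> 1 = 1" "\<And>us. us \<noteq> [] \<Longrightarrow> \<epsilon> (prod_list (map sym_vec us)) = 0"
  shows "sym_deg0 x = \<epsilon> x"
proof -
  let ?P = "cvec.span (\<Union>m\<in>{1..}. sym_grade m) :: 'u sym_alg set"
  have grade: "\<epsilon> y = 0" if "y \<in> sym_grade m" "m \<ge> 1" for y m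
    using \<epsilon>(1) _ that(1)[unfolded sym_grade_def]
    by (rule clinear_zero_on_span) (use that(2) in \<open>auto intro!: \<epsilon>(3)\<close>)
  have zero: "\<epsilon> y = 0" if "y \<in> ?P" for y
    using \<epsilon>(1) _ that by (rule clinear_zero_on_span) (auto intro: grade)
  have "x - \<epsilon> x *\<^sub>C 1 \<in> ?P"
  proof (rule clinear_in_subspace[where f = "\<lambda>x. x - \<epsilon> x *\<^sub>C 1"
        and S = "range (\<lambda>us. prod_list (map sym_vec us))"])
    show "clinear (\<lambda>x. x - \<epsilon> x *\<^sub>C 1)"
      using \<epsilon>(1) by (simp add: clinear_iff scaleC_add_left cvec.scale_right_diff_distrib
          scaleC_scaleC scaleC_complex_def)
    fix y :: "'u sym_alg"
    assume "y \<in> range (\<lambda>us. prod_list (map sym_vec us))"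
    then obtain us where y: "y = prod_list (map sym_vec us)" by blast
    show "y - \<epsilon> y *\<^sub>C 1 \<in> ?P"
    proof (cases "us = []")
      case True
      then show ?thesis by (simp add: y \<epsilon>(2) scaleC_one cvec.span_zero)
    next
      case False
      then have "y \<in> sym_grade (length us)" "length us \<ge> 1"
        by (auto simp: y sym_grade_def Suc_le_eq intro: cvec.span_base)
      then have "y \<in> ?P" by (intro cvec.span_base) blast
      then show ?thesis by (simp add: y \<epsilon>(3) False)
    qed
  qed (simp_all add: span_sym_words)
  moreover have "c = \<epsilon> x" if "x - c *\<^sub>C 1 \<in> ?P" for c
    using zero[OF that] \<epsilon>(1,2)
    by (simp add: clinear_diff clinear_scale scaleC_complex_def)
  ultimately show ?thesis unfolding sym_deg0_def by (intro the_equality)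
qed

text \<open>The Wick functional composed with symmetrization has the properties that characterize
  \<open>sym_deg0\<close>. Surjectivity makes \<open>eta\<close> a right inverse of
  \<open>symmetrization\<close>, so composing with \<open>eta\<close> gives back the Wick
  functional.\<close>

lemma deg0_linear_and_word:
  "clinear (deg0 :: 'u::complex_vector weyl_alg \<Rightarrow> complex) \<and>
   (\<forall>us :: ('u \<times> 'u cdual) list. deg0 (prod_list (map weyl_vec us)) = wick us)"
proof -
  obtain \<tau> :: "'u weyl_alg \<Rightarrow> complex"
    where \<tau>: "clinear \<tau>" "\<And>us. \<tau> (prod_list (map weyl_vec us)) = wick us"
    using weyl_alg_lift[OF word_multilinear_wick] wick_commutator
    by (metis (no_types, lifting) scaleC_complex_def)
  have sym: "\<tau> (symmetrize weyl_word us) = symmetrize wick us" for us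
    using \<tau> by (simp add: symmetrize_def clinear_scale clinear_sum weyl_word_def)
  have "sym_deg0 y = \<tau> (symmetrization y)" for y
  proof (rule sym_deg0_eq)
    show "clinear (\<lambda>y. \<tau> (symmetrization y))"
      by (rule clinear_compose[OF clinear_symmetrization \<tau>(1)])
    show "\<tau> (symmetrization 1) = 1"
      using symmetrization_word[of "[] :: ('u \<times> 'u cdual) list"] sym[of "[]"]
      by (simp add: symmetrize_def scaleC_complex_def)
    show "\<tau> (symmetrization (prod_list (map sym_vec us))) = 0" if "us \<noteq> []" for us
      using that by (simp add: symmetrization_word sym symmetrize_wick)
  qed
  then have "deg0 = \<tau>"
    by (simp add: fun_eq_iff deg0_def eta_def surj_f_inv_f[OF surj_symmetrization])
  then show ?thesis using \<tau> by simp
qed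

lemmas clinear_deg0 = deg0_linear_and_word[THEN conjunct1]
  and deg0_word = deg0_linear_and_word[THEN conjunct2, rule_format]

section \<open>The element \<open>\<nu>'([s\<^sub>\<alpha>, s\<^sub>\<beta>])\<close>\<close>

lemma linear_representation:
  assumes "cvec.independent E" "cvec.span E = UNIV"
  shows "clinear (\<lambda>v. cvec.representation E v e)"
  using assms
  by (simp add: clinear_iff cvec.representation_add cvec.representation_scale scaleC_complex_def)

lemma ev_dual_vec:
  assumes "cvec.independent E" "cvec.span E = UNIV"
  shows "ev (dual_vec E e) v = cvec.representation E v e"
  unfolding dual_vec_def using linear_representation[OF assms]
  by (simp add: Abs_cdual_inverse)

lemma clinear_ev: "clinear (ev l)"
  using ev by simp

lemma ev_sum: "ev (\<Sum>e\<in>S. l e) v = (\<Sum>e\<in>S. ev (l e) v)"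
  by (induction S rule: infinite_finite_induct) (simp_all add: zero_cdual.rep_eq plus_cdual.rep_eq)

lemma dual_vec_expansion:
  assumes E: "cvec.independent E" "cvec.span E = UNIV" and fin: "finite E"
  shows "(\<Sum>e\<in>E. ev l e *\<^sub>C dual_vec E e) = l"
proof -
  have "(\<Sum>e\<in>E. ev l e * cvec.representation E v e) = ev l v" for v
  proof -
    have "v = (\<Sum>e\<in>E. cvec.representation E v e *\<^sub>C e)"
      using cvec.sum_representation_eq[OF E(1) _ fin, of v] E(2) by simp
    then have "ev l v = (\<Sum>e\<in>E. ev l (cvec.representation E v e *\<^sub>C e))"
      using clinear_sum[OF clinear_ev] by metis
    then show ?thesis
      by (simp add: clinear_scale[OF clinear_ev] scaleC_complex_def mult.commute)
  qed
  then show ?thesis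
    by (simp add: ev_inject[symmetric] fun_eq_iff ev_sum scaleC_cdual.rep_eq ev_dual_vec[OF E])
qed

text \<open>Expanding \<open>l\<close> in the dual basis collapses the sum over \<open>E\<close> to
  a single product, so the choice of basis disappears.\<close>

lemma nu_rank_one:
  assumes E: "cvec.independent E" "cvec.span E = UNIV" and fin: "finite E"
  shows "nu E (\<lambda>v. ev l v *\<^sub>C w) = weyl_vec (w, 0) * weyl_vec (0, l)"
proof -
  have "nu E (\<lambda>v. ev l v *\<^sub>C w) = weyl_vec (w, 0) * (\<Sum>e\<in>E. weyl_vec (ev l e *\<^sub>C (0, dual_vec E e)))"
  proof -
    have "weyl_vec (c *\<^sub>C w, 0) = c *\<^sub>C weyl_vec (w, 0)" for c
      using weyl_vec_scale[of c "(w, 0)"] by (simp add: scaleC_prod_def)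
    then show ?thesis
      by (simp add: nu_def sum_distrib_left weyl_vec_scale weyl_alg_scaleC_mult weyl_alg_mult_scaleC)
  qed
  also have "(\<Sum>e\<in>E. weyl_vec (ev l e *\<^sub>C (0, dual_vec E e)))
      = weyl_vec (\<Sum>e\<in>E. ev l e *\<^sub>C (0, dual_vec E e))"
    by (simp add: clinear_sum[OF clinear_weyl_vec])
  also have "(\<Sum>e\<in>E. ev l e *\<^sub>C (0 :: 'a, dual_vec E e)) = (0, l)"
    using dual_vec_expansion[OF assms, of l]
    by (simp add: prod_eq_iff fst_sum snd_sum scaleC_prod_def)
  finally show ?thesis .
qed

lemma nu_diff: "nu E (\<lambda>v. f v - g v) = nu E f - nu E g"
proof -
  have "weyl_vec (x - y, 0 :: 'a cdual) = weyl_vec (x, 0) - weyl_vec (y, 0)" for x y :: 'a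
    using clinear_diff[OF clinear_weyl_vec, of "(x, 0)" "(y, 0)"] by simp
  then show ?thesis
    by (simp add: nu_def sum_subtractf left_diff_distrib)
qed

text \<open>The square expands into four words of length four. The two pure squares have degree zero
  component 0, and the two cross terms contribute equally.\<close>

lemma deg0_nu_square:
  assumes E: "cvec.independent E" "cvec.span E = UNIV" and fin: "finite E"
  shows "deg0 ((nu E (\<lambda>x. (c * ev l x) *\<^sub>C v - (d * ev m x) *\<^sub>C w))\<^sup>2)
    = c * d / 2 * (ev m v * ev l w - ev l v * ev m w)"
proof -
  have rank: "nu E (\<lambda>x. (c * ev l x) *\<^sub>C v) = c *\<^sub>C (weyl_vec (v, 0) * weyl_vec (0, l))" for c l v
  proof -
    have "nu E (\<lambda>x. ev (c *\<^sub>C l) x *\<^sub>C v) = weyl_vec (v, 0) * weyl_vec (c *\<^sub>C (0, l))"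
      by (simp add: nu_rank_one[OF E fin] scaleC_prod_def)
    then show ?thesis
      by (simp add: scaleC_cdual.rep_eq weyl_vec_scale weyl_alg_mult_scaleC)
  qed
  \<comment> \<open>Of the three pairings of four letters, the one joining \<open>v\<close> to
    \<open>w\<close> and \<open>l\<close> to \<open>m\<close> vanishes by isotropy. The other two
    have opposite signs, as \<open>l\<close> stands before \<open>w\<close> but every other vector
    stands before its functional.\<close>
  have four: "deg0 (weyl_vec (v, 0) * weyl_vec (0, l) * (weyl_vec (w, 0) * weyl_vec (0, m)))
      = (ev l v * ev m w - ev m v * ev l w) / 4" for v l w m
  proof -
    have "weyl_vec (v, 0) * weyl_vec (0, l) * (weyl_vec (w, 0) * weyl_vec (0, m))
        = prod_list (map weyl_vec [(v, 0), (0, l), (w, 0), (0, m)])"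
      by (simp add: mult.assoc)
    then show ?thesis
      by (simp only: deg0_word)
         (simp add: wick_Cons symp_form_def zero_cdual.rep_eq clinear_zero[OF clinear_ev]
           algebra_simps del: wick.simps(2))
  qed
  show ?thesis
    by (simp add: nu_diff rank power2_eq_square left_diff_distrib right_diff_distrib
        weyl_alg_scaleC_mult weyl_alg_mult_scaleC scaleC_scaleC clinear_diff[OF clinear_deg0]
        clinear_scale[OF clinear_deg0] four scaleC_complex_def)
       (simp add: field_simps)
qed

section \<open>Complexified roots, reflections and forms\<close>

lemma cplx_vec_add: "cplx_vec (x + y) = cplx_vec x + cplx_vec y"
  and cplx_vec_scale: "cplx_vec (r *\<^sub>R x) = complex_of_real r *\<^sub>C cplx_vec x"
  and cplx_vec_decompose: "v = cplx_vec (re_part v) + \<i> *\<^sub>C cplx_vec (im_part v)"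
  by (simp_all add: cplx_vec_def plus_cplx_def scaleC_cplx_def)

text \<open>A real spanning set still spans after complexification, which bounds independent sets.
  Finiteness of the basis makes the sum in \<open>nu\<close> a genuine one.\<close>

lemma cplx_finite_dim:
  fixes S :: "'v::real_vector set"
  assumes "finite S" "span S = UNIV" "cvec.independent (E :: 'v cplx set)"
  shows "finite E"
proof -
  have sub: "cplx_vec x \<in> cvec.span (cplx_vec ` S)" for x :: 'v
  proof -
    have "x \<in> span S" using assms(2) by simp
    then show ?thesis
    proof (rule span_induct)
      show "subspace {x. cplx_vec x \<in> cvec.span (cplx_vec ` S)}"
        using cvec.span_zero[of "cplx_vec ` S"]
        by (auto simp: subspace_def cplx_vec_add cplx_vec_scale cvec.span_add cvec.span_scale)
           (simp add: cplx_vec_def zero_cplx_def)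
    qed (simp add: cvec.span_base)
  qed
  have "v \<in> cvec.span (cplx_vec ` S)" for v
    by (subst cplx_vec_decompose[of v]) (intro cvec.span_add cvec.span_scale sub)
  then show ?thesis
    using cvec.independent_span_bound[of "cplx_vec ` S" E] assms by auto
qed

lemma ev_cplx_fun:
  assumes "linear \<alpha>"
  shows "ev (cplx_fun \<alpha>) v = Complex (\<alpha> (re_part v)) (\<alpha> (im_part v))"
proof -
  have "clinear (\<lambda>v. Complex (\<alpha> (re_part v)) (\<alpha> (im_part v)))"
    using assms
    by (simp add: clinear_iff plus_cplx_def scaleC_cplx_def scaleC_complex_def complex_eq_iff
        linear_add linear_diff linear_scale)
  then show ?thesis by (simp add: cplx_fun_def Abs_cdual_inverse)
qed

lemma ev_cplx_fun_cplx_vec: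
  "linear \<alpha> \<Longrightarrow> ev (cplx_fun \<alpha>) (cplx_vec x) = complex_of_real (\<alpha> x)"
  by (simp add: ev_cplx_fun cplx_vec_def linear_0 complex_eq_iff)

text \<open>In the composite of two reflections only the doubly reflected term depends on their
  order, so the commutator is a difference of two rank one maps.\<close>

lemma commutator_crefl:
  "commutator (crefl coroot \<alpha>) (crefl coroot \<beta>) =
    (\<lambda>v. (ev (cplx_fun \<alpha>) (cplx_vec (coroot \<beta>)) * ev (cplx_fun \<beta>) v) *\<^sub>C cplx_vec (coroot \<alpha>)
       - (ev (cplx_fun \<beta>) (cplx_vec (coroot \<alpha>)) * ev (cplx_fun \<alpha>) v) *\<^sub>C cplx_vec (coroot \<beta>))"
  by (rule ext)
     (simp add: commutator_def crefl_def clinear_diff[OF clinear_ev] clinear_scale[OF clinear_ev]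
       scaleC_complex_def cvec.scale_left_diff_distrib mult.commute)

section \<open>The complexified positive-definite form and its dual\<close>

context
  fixes B :: "'v::real_vector \<Rightarrow> 'v \<Rightarrow> real"
  assumes B: "pos_def_form B"
begin

lemma pos_def_bilinear: "bilinear B"
  using B by (simp add: pos_def_form_def)

lemma clinear_cplx_form_left: "clinear (\<lambda>v. cplx_form B v w)"
  and clinear_cplx_form_right: "clinear (cplx_form B v)"
  by (simp_all add: clinear_iff cplx_form_def plus_cplx_def scaleC_cplx_def scaleC_complex_def
      complex_eq_iff bilinear_ladd[OF pos_def_bilinear] bilinear_radd[OF pos_def_bilinear]
      bilinear_lsub[OF pos_def_bilinear] bilinear_rsub[OF pos_def_bilinear]
      bilinear_lmul[OF pos_def_bilinear] bilinear_rmul[OF pos_def_bilinear] algebra_simps)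

lemma cplx_form_cplx_vec: "cplx_form B (cplx_vec x) (cplx_vec y) = complex_of_real (B x y)"
  by (simp add: cplx_form_def cplx_vec_def complex_eq_iff bilinear_lzero[OF pos_def_bilinear]
      bilinear_rzero[OF pos_def_bilinear])

text \<open>The extended form is bilinear and may have isotropic vectors, so positivity cannot be
  applied to it directly. Testing against real vectors separates real and imaginary parts, and each
  part is determined by \<open>B\<close>.\<close>

lemma riesz_eqI:
  assumes "\<And>w. cplx_form B v w = ev l w"
  shows "riesz (cplx_form B) l = v"
proof -
  have eq: "x = y" if "\<And>z. B x z = B y z" for x y
  proof (rule ccontr)
    assume "x \<noteq> y"
    then have "B (x - y) (x - y) > 0" using B by (simp add: pos_def_form_def)
    then show False by (simp add: bilinear_lsub[OF pos_def_bilinear] that)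
  qed
  have "u = v" if u: "\<forall>w. cplx_form B u w = ev l w" for u
  proof -
    have "cplx_form B u (cplx_vec z) = cplx_form B v (cplx_vec z)" for z
      using u assms by simp
    then have "B (re_part u) z = B (re_part v) z" "B (im_part u) z = B (im_part v) z" for z
      by (simp_all add: cplx_form_def cplx_vec_def bilinear_rzero[OF pos_def_bilinear])
    then show ?thesis by (intro cplx.expand conjI eq)
  qed
  then show ?thesis
    unfolding riesz_def using assms by (intro the_equality) auto
qed

section \<open>Roots, coroots and the invariant form\<close>

context
  fixes Phi :: "('v \<Rightarrow> real) set" and coroot :: "('v \<Rightarrow> real) \<Rightarrow> 'v"
  assumes inv: "invariant_form Phi coroot B" and Phi: "real_root_system Phi coroot"
begin

text \<open>Invariance under the reflection in \<alpha> is applied to the pair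
  \<open>coroot \<alpha>\<close> and \<open>v\<close>; the reflection negates
  \<open>coroot \<alpha>\<close>.\<close>

lemma form_coroot:
  assumes "\<alpha> \<in> Phi"
  shows "2 * B (coroot \<alpha>) v = B (coroot \<alpha>) (coroot \<alpha>) * \<alpha> v"
proof -
  let ?s = "\<lambda>v. v - \<alpha> v *\<^sub>R coroot \<alpha>"
  have "?s \<circ> id \<in> weyl_group Phi coroot"
    using assms by (intro weyl_group.intros)
  then have "B (?s (coroot \<alpha>)) (?s v) = B (coroot \<alpha>) v"
    using inv by (fastforce simp: invariant_form_def)
  moreover have "?s (coroot \<alpha>) = - coroot \<alpha>"
    using real_root_system.root_coroot[OF Phi assms] by (simp add: scaleR_2)
  ultimately show ?thesis
    by (simp add: bilinear_lneg[OF pos_def_bilinear] bilinear_rsub[OF pos_def_bilinear]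
        bilinear_rmul[OF pos_def_bilinear] algebra_simps)
qed

lemma form_coroot_pos:
  assumes "\<alpha> \<in> Phi"
  shows "B (coroot \<alpha>) (coroot \<alpha>) > 0"
proof -
  have "coroot \<alpha> \<noteq> 0"
    using real_root_system.root_coroot[OF Phi assms] real_root_system.linear_root[OF Phi assms]
    by (auto simp: linear_0)
  then show ?thesis using B by (simp add: pos_def_form_def)
qed

text \<open>The vector representing \<alpha> under the form; the factor is read off from
  \<open>form_coroot\<close>.\<close>

definition root_dual :: "('v \<Rightarrow> real) \<Rightarrow> 'v cplx" where
  "root_dual \<alpha> = complex_of_real (2 / B (coroot \<alpha>) (coroot \<alpha>)) *\<^sub>C cplx_vec (coroot \<alpha>)"

lemma cplx_form_root_dual:
  assumes "\<alpha> \<in> Phi"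
  shows "cplx_form B (root_dual \<alpha>) w = ev (cplx_fun \<alpha>) w"
proof -
  have "cplx_form B (root_dual \<alpha>) w
      = complex_of_real (2 / B (coroot \<alpha>) (coroot \<alpha>)) * cplx_form B (cplx_vec (coroot \<alpha>)) w"
    unfolding root_dual_def clinear_scale[OF clinear_cplx_form_left] scaleC_complex_def ..
  also have "cplx_form B (cplx_vec (coroot \<alpha>)) w
      = complex_of_real (B (coroot \<alpha>) (coroot \<alpha>) / 2) * ev (cplx_fun \<alpha>) w"
    using form_coroot[OF assms, of "re_part w"] form_coroot[OF assms, of "im_part w"]
    by (simp add: ev_cplx_fun real_root_system.linear_root[OF Phi assms] cplx_form_def
        cplx_vec_def complex_eq_iff bilinear_lzero[OF pos_def_bilinear])
  finally show ?thesis
    using form_coroot_pos[OF assms] by (simp flip: of_real_mult mult.assoc)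
qed

lemma riesz_root: "\<alpha> \<in> Phi \<Longrightarrow> riesz (cplx_form B) (cplx_fun \<alpha>) = root_dual \<alpha>"
  by (intro riesz_eqI cplx_form_root_dual)

lemma Bdual_roots:
  assumes "\<alpha> \<in> Phi" "\<beta> \<in> Phi"
  shows "Bdual B (cplx_fun \<alpha>) (cplx_fun \<beta>) = complex_of_real
    (4 * B (coroot \<alpha>) (coroot \<beta>) / (B (coroot \<alpha>) (coroot \<alpha>) * B (coroot \<beta>) (coroot \<beta>)))"
proof -
  have "Bdual B (cplx_fun \<alpha>) (cplx_fun \<beta>) = cplx_form B (root_dual \<alpha>) (root_dual \<beta>)"
    using assms by (simp add: dual_form_def riesz_root)
  then show ?thesis
    unfolding root_dual_def
    by (simp add: clinear_scale[OF clinear_cplx_form_left] clinear_scale[OF clinear_cplx_form_right]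
        cplx_form_cplx_vec scaleC_complex_def)
qed

text \<open>The vector representing \<open>rho P k\<close> is half the weighted sum of the vectors
  \<open>root_dual \<alpha>\<close>. The form is complex bilinear, so the two halves give 1/4 and no
  parameter is conjugated.\<close>

lemma Bdual_rho:
  assumes "P \<subseteq> Phi"
  shows "Bdual B (rho P k) (rho P k)
    = 1/4 * (\<Sum>\<alpha>\<in>P. \<Sum>\<beta>\<in>P. k \<alpha> * k \<beta> * Bdual B (cplx_fun \<alpha>) (cplx_fun \<beta>))"
proof -
  let ?r = "(1/2) *\<^sub>C (\<Sum>\<alpha>\<in>P. k \<alpha> *\<^sub>C root_dual \<alpha>)"
  have "cplx_form B ?r w = ev (rho P k) w" for w
  proof -
    have "cplx_form B ?r w = 1/2 * (\<Sum>\<alpha>\<in>P. k \<alpha> * cplx_form B (root_dual \<alpha>) w)"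
      unfolding clinear_scale[OF clinear_cplx_form_left] clinear_sum[OF clinear_cplx_form_left]
        scaleC_complex_def ..
    also have "(\<Sum>\<alpha>\<in>P. k \<alpha> * cplx_form B (root_dual \<alpha>) w) = (\<Sum>\<alpha>\<in>P. k \<alpha> * ev (cplx_fun \<alpha>) w)"
      using assms by (intro sum.cong) (auto simp: cplx_form_root_dual)
    finally show ?thesis by (simp add: rho_def ev_sum scaleC_cdual.rep_eq)
  qed
  then have "riesz (cplx_form B) (rho P k) = ?r" by (rule riesz_eqI)
  then have "Bdual B (rho P k) (rho P k)
      = 1/2 * (\<Sum>\<alpha>\<in>P. k \<alpha> * (1/2 * (\<Sum>\<beta>\<in>P. k \<beta> * cplx_form B (root_dual \<alpha>) (root_dual \<beta>))))"
    unfolding dual_form_def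
    by (simp only: clinear_scale[OF clinear_cplx_form_left] clinear_sum[OF clinear_cplx_form_left]
        scaleC_complex_def)
       (simp only: clinear_scale[OF clinear_cplx_form_right]
        clinear_sum[OF clinear_cplx_form_right] scaleC_complex_def)
  also have "\<dots> = 1/4 * (\<Sum>\<alpha>\<in>P. \<Sum>\<beta>\<in>P. k \<alpha> * k \<beta> * cplx_form B (root_dual \<alpha>) (root_dual \<beta>))"
    by (simp add: sum_distrib_left mult.assoc sum_divide_distrib)
  also have "\<dots> = 1/4 * (\<Sum>\<alpha>\<in>P. \<Sum>\<beta>\<in>P. k \<alpha> * k \<beta> * Bdual B (cplx_fun \<alpha>) (cplx_fun \<beta>))"
  proof -
    have "cplx_form B (root_dual \<alpha>) (root_dual \<beta>) = Bdual B (cplx_fun \<alpha>) (cplx_fun \<beta>)"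
      if "\<alpha> \<in> P" "\<beta> \<in> P" for \<alpha> \<beta>
      using that[THEN subsetD[OF assms]] by (simp add: dual_form_def riesz_root)
    then show ?thesis by simp
  qed
  finally show ?thesis .
qed

text \<open>The product of \<open>\<alpha> (coroot \<beta>)\<close> and
  \<open>\<beta> (coroot \<alpha>)\<close> is \<open>c = 4 * b\<^sup>2 / (p * q)\<close>, and the
  claimed value is \<open>2 * c - c\<^sup>2 / 2\<close> in factored form.\<close>

lemma deg0_nu_commutator:
  assumes "\<alpha> \<in> Phi" "\<beta> \<in> Phi" and E: "cvec.independent E" "cvec.span E = UNIV" "finite E"
  defines "b \<equiv> B (coroot \<alpha>) (coroot \<beta>)"
    and "p \<equiv> B (coroot \<alpha>) (coroot \<alpha>)" and "q \<equiv> B (coroot \<beta>) (coroot \<beta>)"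
  shows "deg0 ((nu E (commutator (crefl coroot \<alpha>) (crefl coroot \<beta>)))\<^sup>2)
    = complex_of_real (8 * b\<^sup>2 / (p * q) * (1 - b\<^sup>2 / (p * q)))"
proof -
  note lin = real_root_system.linear_root[OF Phi]
  have pq: "p > 0" "q > 0" using form_coroot_pos assms by simp_all
  have sym: "B x y = B y x" for x y using B by (simp add: pos_def_form_def)
  have \<alpha>\<beta>: "\<alpha> (coroot \<beta>) = 2 * b / p" "\<beta> (coroot \<alpha>) = 2 * b / q"
    using form_coroot[OF assms(1), of "coroot \<beta>"] form_coroot[OF assms(2), of "coroot \<alpha>"] pq
      sym[of "coroot \<beta>" "coroot \<alpha>"]
    by (simp_all add: b_def p_def q_def field_simps)
  show ?thesis
    unfolding commutator_crefl deg0_nu_square[OF E]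
      ev_cplx_fun_cplx_vec[OF lin[OF assms(1)]] ev_cplx_fun_cplx_vec[OF lin[OF assms(2)]]
      \<alpha>\<beta> real_root_system.root_coroot[OF Phi assms(1)] real_root_system.root_coroot[OF Phi assms(2)]
    using pq by (simp add: field_simps power2_eq_square complex_eq_iff)
qed

end

end

section \<open>The identity for each pair of roots, and its sum over pairs\<close>

theorem proposition4p14:
  fixes Phi P :: "('v::real_vector \<Rightarrow> real) set"
    and coroot :: "('v \<Rightarrow> real) \<Rightarrow> 'v"
    and B :: "'v \<Rightarrow> 'v \<Rightarrow> real"
    and k :: "('v \<Rightarrow> real) \<Rightarrow> complex"
    and E :: "'v cplx set"
  assumes "real_root_system Phi coroot"
    and "positive_system Phi P"
    and "pos_def_form B" and "invariant_form Phi coroot B"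
    and "invariant_param Phi coroot k"
    and "cvec.independent E" and "cvec.span E = UNIV"
  shows "deg0 (nu_Omega coroot P B k E) =
    1/2 * Bdual B (rho P k) (rho P k)
    - 1/8 * (\<Sum>\<alpha>\<in>P. \<Sum>\<beta>\<in>P. k \<alpha> * k \<beta> *
        (Bdual B (cplx_fun \<alpha>) (cplx_fun \<beta>) ^ 3
          / (Bdual B (cplx_fun \<alpha>) (cplx_fun \<alpha>) * Bdual B (cplx_fun \<beta>) (cplx_fun \<beta>))))"
proof -
  \<comment> \<open>The order is that of the assumptions of the two contexts: positivity,
    invariance, root system.\<close>
  note facts = assms(3,4,1)
  have P: "P \<subseteq> Phi" using assms(2) by (auto simp: positive_system_def)
  have fin: "finite E"
    using real_root_system.finite_dim[OF assms(1)] cplx_finite_dim assms(6) by blast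
  let ?D = "\<lambda>\<alpha> \<beta>. Bdual B (cplx_fun \<alpha>) (cplx_fun \<beta>)"
  have "deg0 (nu_Omega coroot P B k E) = 1/16 * (\<Sum>\<alpha>\<in>P. \<Sum>\<beta>\<in>P.
     (k \<alpha> * k \<beta> * (1 / cplx_form B (cplx_vec (coroot \<alpha>)) (cplx_vec (coroot \<beta>)))) *
       deg0 ((nu E (commutator (crefl coroot \<alpha>) (crefl coroot \<beta>)))\<^sup>2))"
    by (simp only: nu_Omega_def clinear_scale[OF clinear_deg0] clinear_sum[OF clinear_deg0]
        scaleC_complex_def)
  also have "\<dots> = 1/16 * (\<Sum>\<alpha>\<in>P. \<Sum>\<beta>\<in>P.
      2 * (k \<alpha> * k \<beta> * ?D \<alpha> \<beta>) - 2 * (k \<alpha> * k \<beta> * (?D \<alpha> \<beta> ^ 3 / (?D \<alpha> \<alpha> * ?D \<beta> \<beta>))))"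
  proof (intro arg_cong[where f = "(*) (1/16)"] sum.cong refl)
    fix \<alpha> \<beta> assume "\<alpha> \<in> P" "\<beta> \<in> P"
    then have \<alpha>: "\<alpha> \<in> Phi" and \<beta>: "\<beta> \<in> Phi" using P by auto
    define b p q where "b = B (coroot \<alpha>) (coroot \<beta>)" and "p = B (coroot \<alpha>) (coroot \<alpha>)"
      and "q = B (coroot \<beta>) (coroot \<beta>)"
    have pq: "p > 0" "q > 0"
      using form_coroot_pos[OF facts] \<alpha> \<beta> by (simp_all add: p_def q_def)
    have simplify: "4 * p / (p * p) * (4 * q / (q * q)) = 16 / (p * q)"
      using pq by (simp add: field_simps)
    have eq: "1 / b * (8 * b\<^sup>2 / (p * q) * (1 - b\<^sup>2 / (p * q)))
        = 2 * (4 * b / (p * q)) - 2 * ((4 * b / (p * q)) ^ 3 / ((4 * p / (p * p)) * (4 * q / (q * q))))"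
    proof -
      \<comment> \<open>Here \<open>u\<close> stands for \<open>p * q\<close>. For
        \<open>b = 0\<close> both sides vanish because \<open>1 / 0 = 0\<close>, which matches the
        convention that orthogonal pairs contribute nothing.\<close>
      have "1 / b * (8 * b\<^sup>2 / u * (1 - b\<^sup>2 / u)) = 2 * (4 * b / u) - 2 * ((4 * b / u) ^ 3 / (16 / u))"
        if "u > 0" for u
        using that
        by (cases "b = 0") (simp_all add: field_simps power2_eq_square power3_eq_cube)
      then show ?thesis unfolding simplify using pq by simp
    qed
    have key: "1 / complex_of_real b * complex_of_real (8 * b\<^sup>2 / (p * q) * (1 - b\<^sup>2 / (p * q)))
        = 2 * ?D \<alpha> \<beta> - 2 * (?D \<alpha> \<beta> ^ 3 / (?D \<alpha> \<alpha> * ?D \<beta> \<beta>))"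
      using arg_cong[OF eq, of complex_of_real]
      unfolding Bdual_roots[OF facts \<alpha> \<beta>] Bdual_roots[OF facts \<alpha> \<alpha>] Bdual_roots[OF facts \<beta> \<beta>]
        b_def[symmetric] p_def[symmetric] q_def[symmetric]
      by (simp only: of_real_mult of_real_divide of_real_diff of_real_power of_real_1 of_real_numeral)
    \<comment> \<open>Pulls out the product of the two parameters, which is complex, whereas the
      identity for a pair is the image of a real one.\<close>
    have scaled: "c * (1 / z) * w = 2 * (c * d) - 2 * (c * e)" if "1 / z * w = 2 * d - 2 * e"
      for c d e w z :: complex
    proof -
      have "c * (1 / z) * w = c * (1 / z * w)" by (simp only: mult.assoc)
      then show ?thesis unfolding that by (simp add: algebra_simps)
    qed
    show "k \<alpha> * k \<beta> * (1 / cplx_form B (cplx_vec (coroot \<alpha>)) (cplx_vec (coroot \<beta>))) *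
        deg0 ((nu E (commutator (crefl coroot \<alpha>) (crefl coroot \<beta>)))\<^sup>2)
      = 2 * (k \<alpha> * k \<beta> * ?D \<alpha> \<beta>) - 2 * (k \<alpha> * k \<beta> * (?D \<alpha> \<beta> ^ 3 / (?D \<alpha> \<alpha> * ?D \<beta> \<beta>)))"
      unfolding deg0_nu_commutator[OF facts \<alpha> \<beta> assms(6,7) fin] cplx_form_cplx_vec[OF facts(1)]
        b_def[symmetric] p_def[symmetric] q_def[symmetric]
      by (rule scaled) (rule key)
  qed
  \<comment> \<open>The factor 2 in each summand turns 1/16 into 1/8; in the first sum this is 1/2
    times the 1/4 of \<open>Bdual_rho\<close>.\<close>
  also have "\<dots> = 1/8 * (\<Sum>\<alpha>\<in>P. \<Sum>\<beta>\<in>P. k \<alpha> * k \<beta> * ?D \<alpha> \<beta>)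
      - 1/8 * (\<Sum>\<alpha>\<in>P. \<Sum>\<beta>\<in>P. k \<alpha> * k \<beta> * (?D \<alpha> \<beta> ^ 3 / (?D \<alpha> \<alpha> * ?D \<beta> \<beta>)))"
    by (simp only: sum_subtractf sum_distrib_left[symmetric]) (simp add: right_diff_distrib)
  also have "1/8 * (\<Sum>\<alpha>\<in>P. \<Sum>\<beta>\<in>P. k \<alpha> * k \<beta> * ?D \<alpha> \<beta>) = 1/2 * Bdual B (rho P k) (rho P k)"
    by (simp add: Bdual_rho[OF facts P])
  finally show ?thesis .
qed

end
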